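(* Let $J_h,J_v>0$ and let $T>0$ be a temperature in the low-temperature regime $k:=\sinh\left(\frac{2J_h}{k_BT}\right)\sinh\left(\frac{2J_v}{k_BT}\right)>1$. Let $\langle\sigma_{0,0}\sigma_{N-1,N}\rangle$ be the next-to-diagonal two-point correlation function of the square lattice Ising model with horizontal and vertical coupling constants $J_h,J_v$. Then the long-range order in the next-to-diagonal direction is the same as the diagonal and horizontal ones, i.e. $$\lim_{N\to\infty}\langle\sigma_{0,0}\sigma_{N-1,N}\rangle=(1-k^{-2})^{1/4}.$$ This holds both in the isotropic case $J_h=J_v$ and in the anisotropic case $J_h\ne J_v$.
   Context: Ising model: on a $2\mathcal{M}\times2\mathcal{N}$ rectangular lattice with periodic boundary conditions, with spins $\sigma_{jk}\in\{1,-1\}$ at vertices $(j,k)$, $-\mathcal{M}\le j\le\mathcal{M}-1$, $-\mathcal{N}\le k\le\mathcal{N}-1$, the energy of a configuration is $$E(\{\sigma\})=-\sum_{j=-\mathcal{M}}^{\mathcal{M}-1}\sum_{k=-\mathcal{N}}^{\mathcal{N}-1}\left(J_h\sigma_{jk}\sigma_{j\,k+1}+J_v\sigma_{jk}\sigma_{j+1\,k}\right),$$ $Z(T)=\sum_{\{\sigma\}}e^{-E(\{\sigma\})/k_BT}$ is the partition function ($k_B>0$ the Boltzmann constant), and $$\langle\sigma_{0,0}\sigma_{N,M}\rangle=\lim_{\mathcal{M},\mathcal{N}\to\infty}\frac{1}{Z(T)}\sum_{\{\sigma\}}\sigma_{0,0}\sigma_{N,M}e^{-E(\{\sigma\})/k_BT}.$$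 (The known diagonal and horizontal values for $k>1$ are $\lim_N\langle\sigma_{0,0}\sigma_{N,N}\rangle=\lim_N\langle\sigma_{0,0}\sigma_{0,N}\rangle=(1-k^{-2})^{1/4}$.) Representation taken as known (Au-Yang and Perk): write $S_h=\sinh\frac{2J_h}{k_BT}$, $S_v=\sinh\frac{2J_v}{k_BT}$, $C_h=\cosh\frac{2J_h}{k_BT}$, $C_v=\cosh\frac{2J_v}{k_BT}$, so $k=S_hS_v$. Then $\langle\sigma_{0,0}\sigma_{N-1,N}\rangle=D^B_N[\widehat\phi;\widehat\psi]$, where $$\widehat\phi(z)=\sqrt{\frac{1-k^{-1}z^{-1}}{1-k^{-1}z}},\qquad \widehat\psi(z)=\frac{C_vz\widehat\phi(z)+C_h}{S_v(z-c_* )},\qquad c_*=-\frac{S_h}{S_v}$$ (the singularity of $\widehat\psi$ at $c_*$ is removable; the square root is the product of principal branches $(1-k^{-1}z^{-1})^{1/2}(1-k^{-1}z)^{-1/2}$). Here $D^B_N[\phi;\psi]$ is the determinant of the $N\times N$ matrix whose $(j,l)$ entry ($0\le j,l\le N-1$) is $\phi_{l-j}$ for $l\le N-2$ and $\psi_{N-1-j}$ for $l=N-1$, with Fourier coefficients $f_n=\int_{|z|=1}z^{-n}f(z)\frac{dz}{2\pi iz}$. *)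

theory Defs
  imports "HOL-Complex_Analysis.Complex_Analysis" "Jordan_Normal_Form.Determinant"
begin

section \<open>The Ising model on the periodic \<open>2M \<times> 2N\<close> lattice\<close>

definition ising_sites :: "nat \<Rightarrow> nat \<Rightarrow> (int \<times> int) set" where
  "ising_sites M N = {- int M..int M - 1} \<times> {- int N..int N - 1}"

definition ising_configs :: "nat \<Rightarrow> nat \<Rightarrow> (int \<times> int \<Rightarrow> real) set" where
  "ising_configs M N = ising_sites M N \<rightarrow>\<^sub>E {1, -1}"

text \<open>The successor on \<open>{-L, \<dots>, L - 1}\<close> with periodic boundary conditions.\<close>

definition periodic_succ :: "nat \<Rightarrow> int \<Rightarrow> int" where
  "periodic_succ L i = (if i = int L - 1 then - int L else i + 1)"

text \<open>The first coordinate \<open>j\<close> is the vertical one and the second coordinate \<open>k\<close> is the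
  horizontal one.\<close>

definition ising_energy ::
  "real \<Rightarrow> real \<Rightarrow> nat \<Rightarrow> nat \<Rightarrow> (int \<times> int \<Rightarrow> real) \<Rightarrow> real" where
  "ising_energy Jh Jv M N \<sigma> =
     - (\<Sum>j = - int M..int M - 1. \<Sum>k = - int N..int N - 1.
          Jh * \<sigma> (j, k) * \<sigma> (j, periodic_succ N k) +
          Jv * \<sigma> (j, k) * \<sigma> (periodic_succ M j, k))"

definition ising_partition ::
  "real \<Rightarrow> real \<Rightarrow> real \<Rightarrow> real \<Rightarrow> nat \<Rightarrow> nat \<Rightarrow> real" where
  "ising_partition Jh Jv kB T M N =
     (\<Sum>\<sigma>\<in>ising_configs M N. exp (- ising_energy Jh Jv M N \<sigma> / (kB * T)))"

definition ising_finite_correlation ::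
  "real \<Rightarrow> real \<Rightarrow> real \<Rightarrow> real \<Rightarrow> nat \<Rightarrow> nat \<Rightarrow> int \<times> int \<Rightarrow> real" where
  "ising_finite_correlation Jh Jv kB T M N x =
     (1 / ising_partition Jh Jv kB T M N) *
     (\<Sum>\<sigma>\<in>ising_configs M N.
        \<sigma> (0, 0) * \<sigma> x * exp (- ising_energy Jh Jv M N \<sigma> / (kB * T)))"

text \<open>The product filter lets both side lengths tend to infinity independently.  Lattices too small to contain
  \<open>x\<close> do not affect the limit.\<close>

definition ising_correlation ::
  "real \<Rightarrow> real \<Rightarrow> real \<Rightarrow> real \<Rightarrow> int \<times> int \<Rightarrow> real" where
  "ising_correlation Jh Jv kB T x =
     Lim (at_top \<times>\<^sub>F at_top) (\<lambda>(M, N). ising_finite_correlation Jh Jv kB T M N x)"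

definition ising_modulus :: "real \<Rightarrow> real \<Rightarrow> real \<Rightarrow> real \<Rightarrow> real" where
  "ising_modulus Jh Jv kB T = sinh (2 * Jh / (kB * T)) * sinh (2 * Jv / (kB * T))"

section \<open>Bordered Toeplitz determinants\<close>

definition fourier_coeff :: "(complex \<Rightarrow> complex) \<Rightarrow> int \<Rightarrow> complex" where
  "fourier_coeff f n =
     contour_integral (circlepath 0 1)
       (\<lambda>z. z powi (- n) * f z / (2 * complex_of_real pi * \<i> * z))"

text \<open>The names are qualified because HOL-Analysis has its own \<open>mat\<close> and \<open>det\<close>.\<close>

definition bordered_toeplitz_det ::
  "nat \<Rightarrow> (complex \<Rightarrow> complex) \<Rightarrow> (complex \<Rightarrow> complex) \<Rightarrow> complex" where
  "bordered_toeplitz_det N \<phi> \<psi> =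
     Determinant.det (Matrix.mat N N (\<lambda>(j, l).
       if l = N - 1 then fourier_coeff \<psi> (int N - 1 - int j)
       else fourier_coeff \<phi> (int l - int j)))"

section \<open>The Au-Yang--Perk symbols of the next-to-diagonal correlations\<close>

definition phi_hat :: "real \<Rightarrow> real \<Rightarrow> real \<Rightarrow> real \<Rightarrow> complex \<Rightarrow> complex" where
  "phi_hat Jh Jv kB T z =
     (let k = complex_of_real (ising_modulus Jh Jv kB T)
      in csqrt (1 - inverse k * inverse z) / csqrt (1 - inverse k * z))"

text \<open>The singularity at \<open>c\<close> is removable, and the function is extended by its limit there; for
  \<open>Jh = Jv\<close> this point, \<open>c = -1\<close>, lies on the unit circle.\<close>

definition psi_hat :: "real \<Rightarrow> real \<Rightarrow> real \<Rightarrow> real \<Rightarrow> complex \<Rightarrow> complex" where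
  "psi_hat Jh Jv kB T z =
     (let Sh = complex_of_real (sinh (2 * Jh / (kB * T)));
          Sv = complex_of_real (sinh (2 * Jv / (kB * T)));
          Ch = complex_of_real (cosh (2 * Jh / (kB * T)));
          Cv = complex_of_real (cosh (2 * Jv / (kB * T)));
          c = - Sh / Sv;
          f = (\<lambda>w. (Cv * w * phi_hat Jh Jv kB T w + Ch) / (Sv * (w - c)))
      in if z = c then Lim (at c) f else f z)"

end

theory Submission
  imports Defs
begin

text \<open>The symbol has the Wiener--Hopf factorization \<open>\<phi> = \<phi>\<^sub>+ \<phi>\<^sub>-\<close> with \<open>\<phi>\<^sub>+(z) = (1 - a z)\<close>
  to the power \<open>-1/2\<close>, \<open>\<phi>\<^sub>-(z) = (1 - a / z)\<close> to the power \<open>1/2\<close> and \<open>a = 1 / k\<close>. Conjugating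
  the Toeplitz matrix by triangular Toeplitz matrices of determinant \<open>1\<close> turns it into
  \<open>1 + K\<close>, where the absolute values of all entries of \<open>K\<close> have a sum bounded independently of
  the size. Up to errors that tend to \<open>0\<close>, the determinants are therefore multiplicative in
  \<open>\<phi>\<^sub>+\<close> and in \<open>\<phi>\<^sub>-\<close>. Doubling both exponents leads to \<open>(1 - a / z) / (1 - a z)\<close>, whose
  determinants are exactly \<open>1 - a\<^sup>2\<close>, so the fourth power of the wanted Toeplitz limit is
  \<open>1 - a\<^sup>2\<close>; halving one exponent exhibits the limit as a limit of squares, hence as positive.

  For the border, \<open>\<psi> = \<phi>\<^sub>- (g + h)\<close> on the unit circle with \<open>g\<close> analytic inside and \<open>h\<close> analytic
  outside and vanishing at infinity. Hence the border column is the infinite Toeplitz operator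
  applied to the coefficient sequence \<open>x\<close> of \<open>g / \<phi>\<^sub>+\<close>, and by Cramer's rule the bordered determinant is
  asymptotically \<open>x\<^sub>0 = 1\<close> times the Toeplitz determinant.\<close>

section \<open>A perturbation bound for determinants\<close>

hide_const (open) Determinants.det Finite_Cartesian_Product.mat

text \<open>Row sums enter the determinant estimates through an exponential of their total, and this
  norm is that total. Bounds in terms of it do not depend on the size of the matrix.\<close>

definition entry_norm :: "complex mat \<Rightarrow> real" where
  "entry_norm A = (\<Sum>i<dim_row A. \<Sum>j<dim_col A. norm (A $$ (i, j)))"

lemma entry_norm_nonneg: "entry_norm A \<ge> 0"
  unfolding entry_norm_def by (intro sum_nonneg) auto

lemma entry_norm_carrier:
  assumes "A \<in> carrier_mat n m"
  shows "entry_norm A = (\<Sum>i<n. \<Sum>j<m. norm (A $$ (i, j)))"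
  using assms by (simp add: entry_norm_def)

text \<open>For a Toeplitz factor the column sums stay bounded by the l1 norm of its symbol, while
  its own \<open>entry_norm\<close> grows with the size. Hence the bound uses the column sums of
  \<open>B\<close> only.\<close>

lemma entry_norm_mult_left:
  assumes B: "B \<in> carrier_mat n n" and A: "A \<in> carrier_mat n m"
    and col: "\<And>l. l < n \<Longrightarrow> (\<Sum>i<n. norm (B $$ (i, l))) \<le> c"
  shows "entry_norm (B * A) \<le> c * entry_norm A"
proof -
  have "entry_norm (B * A) = (\<Sum>i<n. \<Sum>j<m. norm (\<Sum>l<n. B $$ (i, l) * A $$ (l, j)))"
    using A B by (subst entry_norm_carrier[where n = n and m = m])
      (auto simp: scalar_prod_def lessThan_atLeast0 intro!: sum.cong)
  also have "\<dots> \<le> (\<Sum>i<n. \<Sum>j<m. \<Sum>l<n. norm (B $$ (i, l)) * norm (A $$ (l, j)))"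
    by (intro sum_mono) (metis (mono_tags, lifting) norm_mult norm_sum sum.cong)
  also have "\<dots> = (\<Sum>i<n. \<Sum>l<n. \<Sum>j<m. norm (B $$ (i, l)) * norm (A $$ (l, j)))"
    by (intro sum.cong refl sum.swap)
  also have "\<dots> = (\<Sum>l<n. \<Sum>i<n. \<Sum>j<m. norm (B $$ (i, l)) * norm (A $$ (l, j)))"
    by (rule sum.swap)
  also have "\<dots> = (\<Sum>l<n. (\<Sum>i<n. norm (B $$ (i, l))) * (\<Sum>j<m. norm (A $$ (l, j))))"
    by (simp add: sum_product)
  also have "\<dots> \<le> (\<Sum>l<n. c * (\<Sum>j<m. norm (A $$ (l, j))))"
    by (intro sum_mono mult_right_mono col sum_nonneg) auto
  also have "\<dots> = c * entry_norm A"
    using A by (simp add: entry_norm_def sum_distrib_left)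
  finally show ?thesis .
qed

lemma entry_norm_transpose: "entry_norm (transpose_mat A) = entry_norm A"
  unfolding entry_norm_def by (subst sum.swap) simp

lemma entry_norm_mult_right:
  assumes A: "A \<in> carrier_mat n m" and B: "B \<in> carrier_mat m m"
    and row: "\<And>l. l < m \<Longrightarrow> (\<Sum>j<m. norm (B $$ (l, j))) \<le> c"
  shows "entry_norm (A * B) \<le> c * entry_norm A"
proof -
  have "entry_norm (transpose_mat B * transpose_mat A) \<le> c * entry_norm (transpose_mat A)"
    using assms by (intro entry_norm_mult_left) auto
  then show ?thesis
    using A B by (metis entry_norm_transpose transpose_mult)
qed

lemma entry_norm_triangle:
  assumes "A \<in> carrier_mat n m" "B \<in> carrier_mat n m"
  shows "entry_norm (A + B) \<le> entry_norm A + entry_norm B"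
  using assms by (simp add: entry_norm_def sum.distrib[symmetric] sum_mono norm_triangle_ineq)

lemma entry_norm_mult:
  assumes A: "A \<in> carrier_mat n n" and B: "B \<in> carrier_mat n m"
  shows "entry_norm (A * B) \<le> entry_norm A * entry_norm B"
proof (rule entry_norm_mult_left[OF A B])
  fix l assume "l < n"
  then show "(\<Sum>i<n. norm (A $$ (i, l))) \<le> entry_norm A"
    unfolding entry_norm_carrier[OF A]
    by (intro sum_mono member_le_sum[where f = "\<lambda>j. norm (A $$ (_, j))"]) auto
qed

text \<open>Expanding the first product, every monomial left after the subtraction contains some
  \<open>d i\<close>; taking norms monomial by monomial gives the right-hand side. The induction
  uses (b + d) P - b Q = b (P - Q) + d P.\<close>

lemma norm_prod_diff_le:
  fixes b d :: "'i \<Rightarrow> complex"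
  assumes "finite I"
  shows "norm ((\<Prod>i\<in>I. b i + d i) - (\<Prod>i\<in>I. b i))
    \<le> (\<Prod>i\<in>I. norm (b i) + norm (d i)) - (\<Prod>i\<in>I. norm (b i))"
  using assms
proof induction
  case (insert x I)
  let ?P = "\<Prod>i\<in>I. b i + d i" and ?Q = "\<Prod>i\<in>I. b i"
  let ?P' = "\<Prod>i\<in>I. norm (b i) + norm (d i)" and ?Q' = "\<Prod>i\<in>I. norm (b i)"
  have "norm ?P \<le> ?P'"
    unfolding prod_norm[symmetric] by (intro prod_mono) (auto intro: norm_triangle_ineq)
  then have "norm (d x) * norm ?P \<le> norm (d x) * ?P'"
    by (intro mult_left_mono) auto
  moreover have "norm (b x) * norm (?P - ?Q) \<le> norm (b x) * (?P' - ?Q')"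
    by (intro mult_left_mono insert.IH) auto
  moreover have "norm ((b x + d x) * ?P - b x * ?Q) \<le> norm (b x) * norm (?P - ?Q) + norm (d x) * norm ?P"
    by (rule order_trans[OF _ norm_triangle_ineq[of "b x * (?P - ?Q)" "d x * ?P", unfolded norm_mult]])
      (simp add: algebra_simps)
  ultimately show ?case
    using insert by (simp add: algebra_simps)
qed simp

text \<open>The difference is a polynomial in the \<open>b i\<close> and \<open>d i\<close> with
  nonnegative coefficients, hence monotone in the \<open>b i\<close>.\<close>

lemma prod_add_minus_prod_mono:
  fixes b c d :: "'i \<Rightarrow> real"
  assumes "finite I" "\<And>i. i \<in> I \<Longrightarrow> 0 \<le> b i \<and> b i \<le> c i \<and> 0 \<le> d i"
  shows "(\<Prod>i\<in>I. b i + d i) - (\<Prod>i\<in>I. b i) \<le> (\<Prod>i\<in>I. c i + d i) - (\<Prod>i\<in>I. c i)"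
  using assms
proof induction
  case (insert x I)
  let ?P = "\<Prod>i\<in>I. b i + d i" and ?Q = "\<Prod>i\<in>I. b i"
  let ?P' = "\<Prod>i\<in>I. c i + d i" and ?Q' = "\<Prod>i\<in>I. c i"
  have 0: "0 \<le> ?P - ?Q"
    using insert.prems by (simp, intro prod_mono) auto
  have "?P \<le> ?P'"
    using insert.prems by (intro prod_mono) auto
  then have "d x * ?P \<le> d x * ?P'"
    using insert.prems by (intro mult_left_mono) auto
  moreover have "b x * (?P - ?Q) \<le> c x * (?P' - ?Q')"
    using insert 0 by (intro mult_mono insert.IH) (auto intro: order_trans)
  ultimately show ?case
    using insert by (simp add: algebra_simps)
qed simp

lemma sum_permutations_le_prod_sum:
  fixes f :: "nat \<Rightarrow> nat \<Rightarrow> real"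
  assumes nn: "\<And>i j. g i j \<ge> 0" "\<And>i j. f i j \<ge> g i j"
  shows "(\<Sum>p | p permutes {0..<n}. (\<Prod>i<n. f i (p i)) - (\<Prod>i<n. g i (p i)))
    \<le> (\<Prod>i<n. \<Sum>j<n. f i j) - (\<Prod>i<n. \<Sum>j<n. g i j)"
proof -
  \<comment> \<open>A permutation is the identity outside the index range, whereas a member of
    \<open>PiE\<close> is \<open>undefined\<close> there. Restriction embeds the former into the
    latter without changing the products; the added maps contribute nonnegative terms.\<close>
  let ?S = "{p. p permutes {0..<n}}" and ?r = "\<lambda>p. restrict p {..<n}"
  let ?F = "\<lambda>p. (\<Prod>i<n. f i (p i)) - (\<Prod>i<n. g i (p i))"
  have inj: "inj_on ?r ?S"
  proof (rule inj_onI, rule ext)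
    fix p q x assume "p \<in> ?S" "q \<in> ?S" and eq: "?r p = ?r q"
    then have "p permutes {0..<n}" "q permutes {0..<n}" by auto
    then show "p x = q x"
      using fun_cong[OF eq, of x] permutes_not_in[of p "{0..<n}" x] permutes_not_in[of q "{0..<n}" x]
      by (cases "x < n") auto
  qed
  have "(\<Sum>p\<in>?S. ?F p) = (\<Sum>p\<in>?S. ?F (?r p))"
    by (intro sum.cong refl) simp
  also have "\<dots> = (\<Sum>p\<in>?r ` ?S. ?F p)"
    using sum.reindex[OF inj, of ?F] by simp
  also have "\<dots> \<le> (\<Sum>p\<in>PiE {..<n} (\<lambda>_. {..<n}). ?F p)"
  proof (rule sum_mono2)
    show "finite (PiE {..<n} (\<lambda>_. {..<n}))"
      by (intro finite_PiE) auto
    show "?r ` ?S \<subseteq> PiE {..<n} (\<lambda>_. {..<n})"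
      using permutes_in_image by fastforce
    fix p show "0 \<le> ?F p"
      using nn by (simp add: prod_mono)
  qed
  also have "\<dots> = (\<Prod>i<n. \<Sum>j<n. f i j) - (\<Prod>i<n. \<Sum>j<n. g i j)"
    by (simp add: sum_subtractf prod_sum_PiE)
  finally show ?thesis .
qed

lemma prod_one_plus_le_exp:
  fixes x :: "'i \<Rightarrow> real"
  assumes "\<And>i. i \<in> I \<Longrightarrow> x i \<ge> 0"
  shows "(\<Prod>i\<in>I. 1 + x i) \<le> exp (\<Sum>i\<in>I. x i)"
proof (cases "finite I")
  case True
  have "(\<Prod>i\<in>I. 1 + x i) \<le> (\<Prod>i\<in>I. exp (x i))"
    using assms by (intro prod_mono) (auto simp: add_nonneg_nonneg)
  then show ?thesis by (simp add: exp_sum True)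
qed simp

text \<open>In the Leibniz formula, bounding the sum over permutations by the sum over all maps turns
  the determinants into products of row sums.\<close>

lemma norm_det_diff_le:
  assumes A: "A \<in> carrier_mat n n" and B: "B \<in> carrier_mat n n"
  shows "norm (det A - det B) \<le> exp (entry_norm (B - 1\<^sub>m n)) * (exp (entry_norm (A - B)) - 1)"
proof -
  define b where "b i j = norm (B $$ (i, j))" for i j
  define d where "d i j = norm (A $$ (i, j) - B $$ (i, j))" for i j
  define \<beta> where "\<beta> i = (\<Sum>j<n. b i j)" for i
  define \<delta> where "\<delta> i = (\<Sum>j<n. d i j)" for i
  define \<kappa> where "\<kappa> i = (\<Sum>j<n. norm ((B - 1\<^sub>m n) $$ (i, j)))" for i
  have "norm (det A - det B) =
      norm (\<Sum>p | p permutes {0..<n}. signof p * ((\<Prod>i<n. A $$ (i, p i)) - (\<Prod>i<n. B $$ (i, p i))))"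
    by (simp add: det_def'[OF A] det_def'[OF B] sum_subtractf right_diff_distrib lessThan_atLeast0)
  also have "\<dots> \<le> (\<Sum>p | p permutes {0..<n}.
      norm (signof p * ((\<Prod>i<n. A $$ (i, p i)) - (\<Prod>i<n. B $$ (i, p i)))))"
    by (rule norm_sum)
  also have "\<dots> \<le> (\<Sum>p | p permutes {0..<n}. (\<Prod>i<n. b i (p i) + d i (p i)) - (\<Prod>i<n. b i (p i)))"
  proof (rule sum_mono)
    fix p
    have "norm (signof p :: complex) = 1" by (simp add: sign_def)
    then show "norm (signof p * ((\<Prod>i<n. A $$ (i, p i)) - (\<Prod>i<n. B $$ (i, p i))))
        \<le> (\<Prod>i<n. b i (p i) + d i (p i)) - (\<Prod>i<n. b i (p i))"
      using norm_prod_diff_le[of "{..<n}" "\<lambda>i. B $$ (i, p i)" "\<lambda>i. A $$ (i, p i) - B $$ (i, p i)"]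
      by (simp add: norm_mult b_def d_def)
  qed
  also have "\<dots> \<le> (\<Prod>i<n. \<Sum>j<n. b i j + d i j) - (\<Prod>i<n. \<Sum>j<n. b i j)"
    by (intro sum_permutations_le_prod_sum) (auto simp: b_def d_def)
  also have "\<dots> = (\<Prod>i<n. \<beta> i + \<delta> i) - (\<Prod>i<n. \<beta> i)"
    by (simp add: \<beta>_def \<delta>_def sum.distrib)
  \<comment> \<open>The row sums of \<open>B\<close> are compared with those of the identity, so
    that the product is controlled by the sum of the \<open>\<kappa> i\<close> and not by the number
    of rows.\<close>
  also have "\<dots> \<le> (\<Prod>i<n. (1 + \<kappa> i) + \<delta> i) - (\<Prod>i<n. 1 + \<kappa> i)"
  proof (intro prod_add_minus_prod_mono conjI)
    fix i assume "i \<in> {..<n}"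
    then have i: "i < n" by simp
    show "0 \<le> \<beta> i" "0 \<le> \<delta> i"
      by (auto simp: \<beta>_def \<delta>_def b_def d_def intro!: sum_nonneg)
    have "\<beta> i \<le> (\<Sum>j<n. norm ((1\<^sub>m n :: complex mat) $$ (i, j)) + norm ((B - 1\<^sub>m n) $$ (i, j)))"
      unfolding \<beta>_def b_def
    proof (rule sum_mono)
      fix j assume "j \<in> {..<n}"
      then have "B $$ (i, j) = (1\<^sub>m n :: complex mat) $$ (i, j) + (B - 1\<^sub>m n) $$ (i, j)"
        using i B by simp
      then show "norm (B $$ (i, j)) \<le> norm ((1\<^sub>m n :: complex mat) $$ (i, j)) + norm ((B - 1\<^sub>m n) $$ (i, j))"
        using norm_triangle_ineq by metis
    qed
    also have "\<dots> = (\<Sum>j<n. norm ((1\<^sub>m n :: complex mat) $$ (i, j))) + \<kappa> i"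
      by (simp only: sum.distrib \<kappa>_def)
    also have "(\<Sum>j<n. norm ((1\<^sub>m n :: complex mat) $$ (i, j))) = 1"
      using i by (simp add: if_distrib cong: if_cong)
    finally show "\<beta> i \<le> 1 + \<kappa> i" .
  qed auto
  \<comment> \<open>Enlarging \<open>\<delta> i\<close> to
    \<open>(1 + \<kappa> i) * \<delta> i\<close> makes the product factor.\<close>
  also have "\<dots> \<le> (\<Prod>i<n. (1 + \<kappa> i) * (1 + \<delta> i)) - (\<Prod>i<n. 1 + \<kappa> i)"
    by (intro diff_mono prod_mono)
      (auto simp: algebra_simps \<kappa>_def \<delta>_def d_def intro!: add_nonneg_nonneg mult_nonneg_nonneg sum_nonneg)
  also have "\<dots> = (\<Prod>i<n. 1 + \<kappa> i) * ((\<Prod>i<n. 1 + \<delta> i) - 1)"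
    by (simp only: prod.distrib right_diff_distrib mult_1_right)
  also have "\<dots> \<le> exp (\<Sum>i<n. \<kappa> i) * (exp (\<Sum>i<n. \<delta> i) - 1)"
    by (intro mult_mono diff_mono prod_one_plus_le_exp prod_nonneg order_refl)
      (auto simp: \<kappa>_def \<delta>_def d_def intro!: add_nonneg_nonneg sum_nonneg prod_ge_1)
  also have "(\<Sum>i<n. \<kappa> i) = entry_norm (B - 1\<^sub>m n)"
    using B by (simp add: entry_norm_def \<kappa>_def)
  also have "(\<Sum>i<n. \<delta> i) = entry_norm (A - B)"
    using A B by (simp add: entry_norm_def \<delta>_def d_def)
  finally show ?thesis .
qed

lemma norm_det_le:
  assumes A: "A \<in> carrier_mat n n"
  shows "norm (det A) \<le> exp (entry_norm (A - 1\<^sub>m n))"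
proof -
  have "entry_norm (1\<^sub>m n - 1\<^sub>m n) = 0"
    by (simp add: entry_norm_def)
  then have "norm (det A - 1) \<le> exp (entry_norm (A - 1\<^sub>m n)) - 1"
    using norm_det_diff_le[OF A one_carrier_mat] by simp
  then show ?thesis
    using norm_triangle_ineq[of "det A - 1" 1] by simp
qed

section \<open>Convolution and correlation of summable sequences\<close>

text \<open>\<open>conv u\<close> and \<open>corr v\<close> are the semi-infinite Toeplitz operators with the symbols
  \<open>\<Sum>u\<^sub>n z\<^sup>n\<close> (lower triangular) and \<open>\<Sum>v\<^sub>n z\<^sup>-\<^sup>n\<close> (upper triangular).\<close>

definition conv :: "(nat \<Rightarrow> complex) \<Rightarrow> (nat \<Rightarrow> complex) \<Rightarrow> nat \<Rightarrow> complex" where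
  "conv u x n = (\<Sum>p\<le>n. u (n - p) * x p)"

definition corr :: "(nat \<Rightarrow> complex) \<Rightarrow> (nat \<Rightarrow> complex) \<Rightarrow> nat \<Rightarrow> complex" where
  "corr v x n = (\<Sum>m. v m * x (n + m))"

text \<open>Multiplication by the j-th power of z. As a sequence, \<open>shift j u\<close> is column
  \<open>j\<close> of the infinite lower triangular Toeplitz matrix of \<open>u\<close>.\<close>

definition shift :: "nat \<Rightarrow> (nat \<Rightarrow> complex) \<Rightarrow> nat \<Rightarrow> complex" where
  "shift j x m = (if j \<le> m then x (m - j) else 0)"

definition unit_seq :: "nat \<Rightarrow> complex" where
  "unit_seq n = (if n = 0 then 1 else 0)"

abbreviation l1 :: "(nat \<Rightarrow> complex) \<Rightarrow> bool" where
  "l1 x \<equiv> summable (\<lambda>n. norm (x n))"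

definition l1_norm :: "(nat \<Rightarrow> complex) \<Rightarrow> real" where
  "l1_norm x = (\<Sum>n. norm (x n))"

text \<open>Through this identity associativity, commutativity and the unit law of
  \<open>conv\<close> are inherited from the ring of formal power series.\<close>

lemma Abs_fps_conv: "Abs_fps (conv u x) = Abs_fps u * Abs_fps x"
  by (subst mult.commute, rule fps_ext) (auto simp: conv_def fps_mult_nth atMost_atLeast0 intro!: sum.cong mult.commute)

lemma conv_eq_fps_nth: "conv u x n = fps_nth (Abs_fps u * Abs_fps x) n"
  by (simp flip: Abs_fps_conv)

lemma conv_assoc: "conv (conv u v) x = conv u (conv v x)"
  by (rule ext) (simp add: conv_eq_fps_nth Abs_fps_conv mult.assoc)

lemma conv_commute: "conv u x = conv x u"
  by (rule ext) (simp add: conv_eq_fps_nth mult.commute)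

lemma conv_unit_seq [simp]: "conv unit_seq x = x" "conv x unit_seq = x"
proof -
  have "Abs_fps unit_seq = 1"
    by (rule fps_ext) (simp add: unit_seq_def)
  then show "conv unit_seq x = x" "conv x unit_seq = x"
    by (auto simp: fun_eq_iff conv_eq_fps_nth)
qed

lemma conv_0: "conv u x 0 = u 0 * x 0"
  by (simp add: conv_def)

lemma conv_shift: "conv u (shift j x) = shift j (conv u x)"
proof
  fix m
  show "conv u (shift j x) m = shift j (conv u x) m"
  proof (cases "j \<le> m")
    case True
    have "conv u (shift j x) m = (\<Sum>p\<in>{j..m}. u (m - p) * x (p - j))"
      unfolding conv_def shift_def by (intro sum.mono_neutral_cong_right) auto
    also have "\<dots> = (\<Sum>p\<le>m - j. u (m - j - p) * x p)"
      by (rule sum.reindex_bij_witness[of _ "\<lambda>p. p + j" "\<lambda>p. p - j"]) (use True in auto)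
    finally show ?thesis
      using True by (simp add: shift_def conv_def)
  qed (simp add: conv_def shift_def)
qed

section \<open>Absolute summability and l1 estimates\<close>

lemma l1_bounded: "l1 x \<Longrightarrow> norm (x n) \<le> l1_norm x"
  unfolding l1_norm_def using sum_le_suminf[of "\<lambda>n. norm (x n)" "{n}"] by simp

lemma l1_norm_nonneg: "l1 x \<Longrightarrow> 0 \<le> l1_norm x"
  using order_trans[OF norm_ge_zero l1_bounded[of x]] by simp

lemma l1_shift: "l1 x \<Longrightarrow> l1 (shift j x)"
  using summable_iff_shift[of "\<lambda>n. norm (shift j x n)" j] by (simp add: shift_def)

lemma l1_summable_corr:
  assumes "l1 v" "l1 x"
  shows "summable (\<lambda>m. norm (v m * x (n + m)))"
proof (rule summable_comparison_test)
  show "summable (\<lambda>m. norm (v m) * l1_norm x)"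
    using assms(1) by (rule summable_mult2)
  show "\<exists>N. \<forall>m\<ge>N. norm (norm (v m * x (n + m))) \<le> norm (v m) * l1_norm x"
    using l1_bounded[OF assms(2)] by (auto simp: norm_mult intro!: mult_left_mono)
qed

lemma conv_l1:
  assumes u: "l1 u" and x: "l1 x"
  shows l1_conv: "l1 (conv u x)" and l1_norm_conv: "l1_norm (conv u x) \<le> l1_norm u * l1_norm x"
proof -
  let ?g = "\<lambda>k. \<Sum>i\<le>k. norm (x i) * norm (u (k - i))"
  have sums: "?g sums (l1_norm x * l1_norm u)"
    unfolding l1_norm_def using u x by (intro Cauchy_product_sums) auto
  have le: "norm (conv u x k) \<le> ?g k" for k
    unfolding conv_def by (rule order_trans[OF norm_sum]) (simp add: norm_mult mult.commute)
  show 1: "l1 (conv u x)"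
    using le sums by (intro summable_comparison_test[OF _ sums_summable[OF sums]]) auto
  show "l1_norm (conv u x) \<le> l1_norm u * l1_norm x"
    using suminf_le[OF le 1 sums_summable[OF sums]] sums_unique[OF sums]
    by (simp add: l1_norm_def mult.commute)
qed

text \<open>After exchanging the sums, each shifted copy of \<open>x\<close> has total mass at most
  \<open>l1_norm x\<close>. The version for partial sums yields summability of
  \<open>corr v x\<close> and also bounds columns of finite matrices.\<close>

lemma sum_norm_corr_le:
  assumes v: "l1 v" and x: "l1 x"
  shows "(\<Sum>i<N. norm (corr v x i)) \<le> l1_norm v * l1_norm x"
proof -
  note s = l1_summable_corr[OF v x]
  have "(\<Sum>i<N. norm (corr v x i)) \<le> (\<Sum>i<N. \<Sum>m. norm (v m * x (i + m)))"
    unfolding corr_def by (intro sum_mono summable_norm s)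
  also have "\<dots> = (\<Sum>m. \<Sum>i<N. norm (v m * x (i + m)))"
    using s by (subst suminf_sum) auto
  also have "\<dots> \<le> (\<Sum>m. norm (v m) * l1_norm x)"
  proof (rule suminf_le)
    fix m
    have "(\<Sum>i<N. norm (x (i + m))) = (\<Sum>i\<in>{m..<N+m}. norm (x i))"
      by (rule sum.reindex_bij_witness[of _ "\<lambda>i. i - m" "\<lambda>i. i + m"]) auto
    also have "\<dots> \<le> l1_norm x"
      unfolding l1_norm_def using x by (intro sum_le_suminf) auto
    finally show "(\<Sum>i<N. norm (v m * x (i + m))) \<le> norm (v m) * l1_norm x"
      by (simp add: norm_mult mult_left_mono flip: sum_distrib_left)
  qed (use s v in \<open>auto intro: summable_sum summable_mult2\<close>)
  also have "\<dots> = l1_norm v * l1_norm x"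
    using v by (simp add: l1_norm_def suminf_mult2)
  finally show ?thesis .
qed

lemma l1_corr: "l1 v \<Longrightarrow> l1 x \<Longrightarrow> l1 (corr v x)"
  by (rule summableI_nonneg_bounded[where x = "l1_norm v * l1_norm x"]) (auto intro: sum_norm_corr_le)

lemma corr_add:
  assumes "l1 v" "l1 x" "l1 y"
  shows "corr v (\<lambda>n. x n + y n) i = corr v x i + corr v y i"
  using l1_summable_corr[OF assms(1,2), of i] l1_summable_corr[OF assms(1,3), of i]
  by (simp add: corr_def distrib_left suminf_add summable_norm_cancel)

lemma corr_sum:
  assumes "l1 v" "\<And>j. j \<in> J \<Longrightarrow> l1 (x j)"
  shows "corr v (\<lambda>n. \<Sum>j\<in>J. x j n * c j) i = (\<Sum>j\<in>J. corr v (x j) i * c j)"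
proof -
  have s: "summable (\<lambda>m. v m * x j (i + m))" if "j \<in> J" for j
    using l1_summable_corr[OF assms(1) assms(2)[OF that]] by (rule summable_norm_cancel)
  have "corr v (\<lambda>n. \<Sum>j\<in>J. x j n * c j) i = (\<Sum>m. \<Sum>j\<in>J. v m * x j (i + m) * c j)"
    by (simp add: corr_def sum_distrib_left mult.assoc)
  also have "\<dots> = (\<Sum>j\<in>J. \<Sum>m. v m * x j (i + m) * c j)"
    using s by (intro suminf_sum summable_mult2)
  also have "\<dots> = (\<Sum>j\<in>J. corr v (x j) i * c j)"
    using s by (simp add: corr_def suminf_mult2)
  finally show ?thesis .
qed

text \<open>Upper triangular Toeplitz operators multiply like their symbols: collecting the terms of
  the double series with m + l = n produces the coefficient \<open>conv v w n\<close>. Absolute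
  summability over all pairs justifies this rearrangement.\<close>

lemma corr_corr:
  assumes v: "l1 v" and w: "l1 w" and x: "l1 x"
  shows "corr v (corr w x) = corr (conv v w) x"
proof
  fix i
  define f where "f m l = v m * (w l * x (i + (m + l)))" for m l
  define \<tau> where "\<tau> = (\<lambda>(n, p). (n - p, p) :: nat \<times> nat)"
  have bij: "bij_betw \<tau> (SIGMA n:UNIV. {..n}) (UNIV \<times> UNIV)"
    by (rule bij_betw_byWitness[where f' = "\<lambda>(m, l). (m + l, l)"]) (auto simp: \<tau>_def)
  have "(\<lambda>z. norm (case z of (m, l) \<Rightarrow> f m l)) summable_on UNIV \<times> UNIV"
  proof (rule Infinite_Sum.abs_summable_on_comparison_test)
    have V: "(\<lambda>n. norm (v n)) summable_on UNIV" and W: "(\<lambda>n. norm (w n)) summable_on UNIV"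
      using v w norm_summable_imp_summable_on[of "\<lambda>n. norm (v n)"]
        norm_summable_imp_summable_on[of "\<lambda>n. norm (w n)"] by simp_all
    \<comment> \<open>Replacing \<open>x\<close> by its uniform bound turns the family into a
      product of two summable ones.\<close>
    let ?g = "\<lambda>z. case z of (m, l) \<Rightarrow> v m * w l * of_real (l1_norm x)"
    have eq: "(\<Sum>\<^sub>\<infinity>l. norm (?g (m, l))) = norm (v m) * ((\<Sum>\<^sub>\<infinity>l. norm (w l)) * norm (l1_norm x))" for m
      by (simp add: norm_mult mult.assoc infsum_cmult_right' infsum_cmult_left')
    show "(\<lambda>z. norm (?g z)) summable_on UNIV \<times> UNIV"
      unfolding Infinite_Sum.abs_summable_on_Sigma_iff eq
    proof (intro conjI ballI)
      show "(\<lambda>l. norm (?g (m, l))) summable_on UNIV" for m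
        unfolding prod.case norm_mult mult.assoc
        by (rule summable_on_cmult_right[OF summable_on_cmult_left[OF W]])
      show "(\<lambda>m. norm (norm (v m) * ((\<Sum>\<^sub>\<infinity>l. norm (w l)) * norm (l1_norm x)))) summable_on UNIV"
        unfolding real_norm_def abs_mult abs_norm_cancel by (rule summable_on_cmult_left[OF V])
    qed
    show "norm (case z of (m, l) \<Rightarrow> f m l)
        \<le> norm (case z of (m, l) \<Rightarrow> v m * w l * of_real (l1_norm x))" for z
      using l1_bounded[OF x] l1_norm_nonneg[OF x]
      by (auto simp: f_def norm_mult mult.assoc split: prod.split intro!: mult_left_mono)
  qed
  then have sf: "(\<lambda>(m, l). f m l) summable_on UNIV \<times> UNIV"
    by (rule abs_summable_summable)
  have lhs: "corr v (corr w x) i = (\<Sum>\<^sub>\<infinity>m. \<Sum>\<^sub>\<infinity>l. f m l)"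
  proof -
    have "(\<Sum>\<^sub>\<infinity>l. f m l) = v m * corr w x (i + m)" for m
    proof -
      have "(\<lambda>l. w l * x (i + m + l)) sums corr w x (i + m)"
        unfolding corr_def by (rule summable_sums[OF summable_norm_cancel[OF l1_summable_corr[OF w x]]])
      then have "((\<lambda>l. w l * x (i + m + l)) has_sum corr w x (i + m)) UNIV"
        by (rule norm_summable_imp_has_sum[OF l1_summable_corr[OF w x]])
      then have "(f m has_sum (v m * corr w x (i + m))) UNIV"
        unfolding f_def by (subst add.assoc[symmetric]) (rule has_sum_cmult_right)
      then show ?thesis by (rule infsumI)
    qed
    moreover have "((\<lambda>m. v m * corr w x (i + m)) has_sum corr v (corr w x) i) UNIV"
      using l1_summable_corr[OF v l1_corr[OF w x], of i] unfolding corr_def[of v]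
      by (intro norm_summable_imp_has_sum summable_sums) (auto dest: summable_norm_cancel)
    ultimately show ?thesis
      by (simp only: infsumI[of _ _ "corr v (corr w x) i"])
  qed
  have rhs: "corr (conv v w) x i = (\<Sum>\<^sub>\<infinity>n. \<Sum>\<^sub>\<infinity>p\<in>{..n}. f (n - p) p)"
  proof -
    have "(\<Sum>\<^sub>\<infinity>p\<in>{..n}. f (n - p) p) = conv v w n * x (i + n)" for n
      by (simp add: f_def conv_def sum_distrib_right mult.assoc)
    moreover have "((\<lambda>n. conv v w n * x (i + n)) has_sum corr (conv v w) x i) UNIV"
      using l1_summable_corr[OF l1_conv[OF v w] x, of i] unfolding corr_def
      by (intro norm_summable_imp_has_sum summable_sums) (auto dest: summable_norm_cancel)
    ultimately show ?thesis
      by (simp only: infsumI[of _ _ "corr (conv v w) x i"])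
  qed
  have sg: "(\<lambda>(n, p). f (n - p) p) summable_on (SIGMA n:UNIV. {..n})"
    using summable_on_reindex_bij_betw[OF bij, of "\<lambda>(m, l). f m l"] sf
    by (simp add: \<tau>_def case_prod_unfold)
  have "(\<Sum>\<^sub>\<infinity>m. \<Sum>\<^sub>\<infinity>l. f m l) = (\<Sum>\<^sub>\<infinity>z\<in>UNIV \<times> UNIV. case z of (m, l) \<Rightarrow> f m l)"
    using sf by (rule infsum_Sigma'_banach)
  also have "\<dots> = (\<Sum>\<^sub>\<infinity>z\<in>(SIGMA n:UNIV. {..n}). case z of (n, p) \<Rightarrow> f (n - p) p)"
    using infsum_reindex_bij_betw[OF bij, of "\<lambda>(m, l). f m l"]
    by (simp add: \<tau>_def case_prod_unfold)
  also have "\<dots> = (\<Sum>\<^sub>\<infinity>n. \<Sum>\<^sub>\<infinity>p\<in>{..n}. f (n - p) p)"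
    using infsum_Sigma'_banach[OF sg] by simp
  finally show "corr v (corr w x) i = corr (conv v w) x i"
    by (simp add: lhs rhs)
qed

section \<open>Truncated Toeplitz matrices\<close>

definition tail :: "nat \<Rightarrow> (nat \<Rightarrow> complex) \<Rightarrow> nat \<Rightarrow> complex" where
  "tail N x n = (if n < N then 0 else x n)"

lemma l1_tail: "l1 x \<Longrightarrow> l1 (tail N x)"
  by (rule summable_comparison_test[where g = "\<lambda>n. norm (x n)"]) (auto simp: tail_def)

lemma l1_norm_tail:
  assumes "l1 x"
  shows "l1_norm (tail N x) = (\<Sum>n. norm (x (n + N)))"
  using suminf_split_initial_segment[OF l1_tail[OF assms, of N], of N]
  by (simp add: l1_norm_def tail_def)

lemma tendsto_l1_norm_tail:
  assumes "l1 x"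
  shows "(\<lambda>N. l1_norm (tail N x)) \<longlonglongrightarrow> 0"
  unfolding l1_norm_tail[OF assms] using suminf_exist_split2[OF assms] .

text \<open>\<open>toep_entry u v i j\<close> depends only on \<open>i - j\<close>: it is the Fourier coefficient of index \<open>i - j\<close> of the
  product of the two symbols.\<close>

definition toep_entry :: "(nat \<Rightarrow> complex) \<Rightarrow> (nat \<Rightarrow> complex) \<Rightarrow> nat \<Rightarrow> nat \<Rightarrow> complex" where
  "toep_entry u v i j = corr v (shift j u) i"

text \<open>An entry of the product of the Hankel matrices of \<open>u\<close> and \<open>v\<close>.
  This product measures how far a truncated Toeplitz matrix is from the product of its triangular
  factors.\<close>

definition hank_entry :: "(nat \<Rightarrow> complex) \<Rightarrow> (nat \<Rightarrow> complex) \<Rightarrow> nat \<Rightarrow> nat \<Rightarrow> complex" where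
  "hank_entry u v i j = (\<Sum>m. u (i + Suc m) * v (j + Suc m))"

lemma hank_entry_swap: "hank_entry v u j i = hank_entry u v i j"
  by (simp add: hank_entry_def mult.commute)

lemma conv_split:
  "conv u x m = (\<Sum>j<N. shift j u m * x j) + conv u (tail N x) m"
proof -
  have "(\<Sum>j<N. shift j u m * x j) = (\<Sum>p\<in>{..m} \<inter> {..<N}. u (m - p) * x p)"
    by (rule sum.mono_neutral_cong_right) (auto simp: shift_def)
  also have "\<dots> = (\<Sum>p\<le>m. if p < N then u (m - p) * x p else 0)"
    by (subst sum.inter_restrict) auto
  finally show ?thesis
    by (simp add: conv_def tail_def flip: sum.distrib cong: if_cong)
      (auto intro!: sum.cong)
qed

text \<open>A finite Toeplitz matrix only sees the first \<open>N\<close> coefficients of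
  \<open>x\<close>. The second term is the truncation error, which is small because the tail of
  \<open>x\<close> is small in l1.\<close>

lemma corr_conv_split:
  assumes "l1 u" "l1 v" "l1 x"
  shows "corr v (conv u x) i = (\<Sum>j<N. toep_entry u v i j * x j) + corr v (conv u (tail N x)) i"
proof -
  have "l1 (\<lambda>m. \<Sum>j<N. shift j u m * x j)"
  proof (rule summable_comparison_test[OF _ summable_sum])
    show "\<exists>M. \<forall>n\<ge>M. norm (norm (\<Sum>j<N. shift j u n * x j)) \<le> (\<Sum>j<N. norm (shift j u n) * norm (x j))"
      by (auto intro!: order_trans[OF norm_sum] simp: norm_mult)
  qed (use l1_shift[OF assms(1)] in \<open>auto intro: summable_mult2\<close>)
  moreover have "conv u x = (\<lambda>m. (\<Sum>j<N. shift j u m * x j) + conv u (tail N x) m)"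
    by (rule ext) (rule conv_split)
  ultimately show ?thesis
    using assms by (simp add: corr_add corr_sum l1_conv l1_tail l1_shift toep_entry_def)
qed

text \<open>The defining series is cut after m = j. With l = j - m the initial segment becomes an
  entry of a lower triangular times an upper triangular matrix; the rest is the Hankel
  series.\<close>

lemma toep_entry_split:
  assumes u: "l1 u" and v: "l1 v"
  shows "toep_entry u v i j = (\<Sum>l\<le>min i j. u (i - l) * v (j - l)) + hank_entry u v i j"
proof -
  have s: "summable (\<lambda>m. v m * shift j u (i + m))"
    using l1_summable_corr[OF v l1_shift[OF u]] by (rule summable_norm_cancel)
  have "(\<Sum>m<Suc j. v m * shift j u (i + m)) = (\<Sum>m\<in>{j - min i j..j}. v m * u (i + m - j))"
    by (rule sum.mono_neutral_cong_right) (auto simp: shift_def min_def split: if_splits)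
  also have "\<dots> = (\<Sum>l\<le>min i j. u (i - l) * v (j - l))"
    by (rule sum.reindex_bij_witness[of _ "\<lambda>l. j - l" "\<lambda>m. j - m"]) (auto simp: mult.commute)
  finally have "(\<Sum>m<Suc j. v m * shift j u (i + m)) = (\<Sum>l\<le>min i j. u (i - l) * v (j - l))" .
  moreover have "(\<Sum>m. v (m + Suc j) * shift j u (i + (m + Suc j))) = hank_entry u v i j"
    by (simp add: hank_entry_def shift_def mult.commute add.commute add.left_commute)
  ultimately show ?thesis
    unfolding toep_entry_def corr_def
    using suminf_split_initial_segment[OF s, of "Suc j"] by simp
qed

text \<open>Exchanging the factors replaces z by 1/z in the symbol, which transposes the matrix.
  Both parts of the splitting are symmetric in this sense.\<close>

lemma toep_entry_swap:
  assumes "l1 u" "l1 v"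
  shows "toep_entry v u j i = toep_entry u v i j"
  using assms by (simp add: toep_entry_split hank_entry_swap[of v u] min.commute mult.commute)

section \<open>Finite sections of Toeplitz and Hankel operators\<close>

definition lower_toep :: "nat \<Rightarrow> (nat \<Rightarrow> complex) \<Rightarrow> complex mat" where
  "lower_toep n u = Matrix.mat n n (\<lambda>(i, j). shift j u i)"

definition upper_toep :: "nat \<Rightarrow> (nat \<Rightarrow> complex) \<Rightarrow> complex mat" where
  "upper_toep n v = Matrix.mat n n (\<lambda>(i, j). shift i v j)"

definition toep :: "nat \<Rightarrow> (nat \<Rightarrow> complex) \<Rightarrow> (nat \<Rightarrow> complex) \<Rightarrow> complex mat" where
  "toep n u v = Matrix.mat n n (\<lambda>(i, j). toep_entry u v i j)"

definition hank :: "nat \<Rightarrow> (nat \<Rightarrow> complex) \<Rightarrow> (nat \<Rightarrow> complex) \<Rightarrow> complex mat" where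
  "hank n u v = Matrix.mat n n (\<lambda>(i, j). hank_entry u v i j)"

lemma toep_carrier [simp]:
  "lower_toep n u \<in> carrier_mat n n" "upper_toep n u \<in> carrier_mat n n"
  "toep n u v \<in> carrier_mat n n" "hank n u v \<in> carrier_mat n n"
  by (auto simp: lower_toep_def upper_toep_def toep_def hank_def)

lemma transpose_lower_toep: "transpose_mat (lower_toep n u) = upper_toep n u"
  by (auto simp: lower_toep_def upper_toep_def)

lemma det_lower_toep: "det (lower_toep n u) = u 0 ^ n"
proof -
  have "diag_mat (lower_toep n u) = replicate n (u 0)"
    by (intro nth_equalityI) (auto simp: diag_mat_def lower_toep_def shift_def)
  then show ?thesis
    by (subst det_lower_triangular[where n = n]) (auto simp: lower_toep_def shift_def)
qed

lemma det_upper_toep: "det (upper_toep n u) = u 0 ^ n"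
  using det_transpose[of "lower_toep n u" n] by (simp add: transpose_lower_toep det_lower_toep)

text \<open>Row \<open>i\<close> of a lower triangular matrix ends at column \<open>i\<close>, so
  truncation loses nothing and the finite sections multiply exactly.\<close>

lemma lower_toep_conv: "lower_toep n u * lower_toep n v = lower_toep n (conv u v)"
proof (rule eq_matI)
  fix i j assume "i < dim_row (lower_toep n (conv u v))" "j < dim_col (lower_toep n (conv u v))"
  then have ij: "i < n" "j < n" by (auto simp: lower_toep_def)
  have "(lower_toep n u * lower_toep n v) $$ (i, j) = (\<Sum>l<n. shift l u i * shift j v l)"
    using ij by (simp add: lower_toep_def scalar_prod_def lessThan_atLeast0)
  also have "\<dots> = (\<Sum>l\<le>i. u (i - l) * shift j v l)"
    using ij by (intro sum.mono_neutral_cong_right) (auto simp: shift_def)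
  also have "\<dots> = shift j (conv u v) i"
    by (simp flip: conv_shift add: conv_def)
  finally show "(lower_toep n u * lower_toep n v) $$ (i, j) = lower_toep n (conv u v) $$ (i, j)"
    using ij by (simp add: lower_toep_def)
qed (auto simp: lower_toep_def)

lemma upper_toep_conv: "upper_toep n u * upper_toep n v = upper_toep n (conv u v)"
  using transpose_mult[of "lower_toep n v" n n "lower_toep n u" n]
  by (simp add: transpose_lower_toep lower_toep_conv conv_commute)

lemma toep_unit_seq: "lower_toep n unit_seq = 1\<^sub>m n" "upper_toep n unit_seq = 1\<^sub>m n"
  by (auto simp: lower_toep_def upper_toep_def shift_def unit_seq_def)

lemma toep_decomp:
  assumes "l1 u" "l1 v"
  shows "toep n u v = lower_toep n u * upper_toep n v + hank n u v"
proof (rule eq_matI)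
  fix i j assume "i < dim_row (lower_toep n u * upper_toep n v + hank n u v)"
    "j < dim_col (lower_toep n u * upper_toep n v + hank n u v)"
  then have ij: "i < n" "j < n" by (auto simp: hank_def)
  have "(lower_toep n u * upper_toep n v) $$ (i, j) = (\<Sum>l<n. shift l u i * shift l v j)"
    using ij by (simp add: lower_toep_def upper_toep_def scalar_prod_def lessThan_atLeast0)
  also have "\<dots> = (\<Sum>l\<le>min i j. u (i - l) * v (j - l))"
    using ij by (intro sum.mono_neutral_cong_right) (auto simp: shift_def)
  finally show "toep n u v $$ (i, j) = (lower_toep n u * upper_toep n v + hank n u v) $$ (i, j)"
    using ij by (simp add: toep_def hank_def toep_entry_split[OF assms])
qed (auto simp: toep_def hank_def)

lemma toep_swap:
  assumes "l1 u" "l1 v"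
  shows "toep n v u = transpose_mat (toep n u v)"
  by (rule eq_matI) (auto simp: toep_def toep_entry_swap[OF assms])

lemma sum_norm_shift_le:
  assumes "l1 u"
  shows "(\<Sum>i<n. norm (shift j u i)) \<le> l1_norm u" "(\<Sum>j<n. norm (shift j u i)) \<le> l1_norm u"
proof -
  have "(\<Sum>i<n. norm (shift j u i)) = (\<Sum>i\<in>{j..<n}. norm (u (i - j)))"
    by (rule sum.mono_neutral_cong_right) (auto simp: shift_def)
  also have "\<dots> = (\<Sum>i<n - j. norm (u i))"
    by (rule sum.reindex_bij_witness[of _ "\<lambda>i. i + j" "\<lambda>i. i - j"]) auto
  also have "\<dots> \<le> l1_norm u"
    unfolding l1_norm_def using assms by (intro sum_le_suminf) auto
  finally show "(\<Sum>i<n. norm (shift j u i)) \<le> l1_norm u" .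
  have "(\<Sum>j<n. norm (shift j u i)) = (\<Sum>j\<in>{..<n} \<inter> {..i}. norm (u (i - j)))"
    by (rule sum.mono_neutral_cong_right) (auto simp: shift_def)
  also have "\<dots> \<le> (\<Sum>j\<le>i. norm (u (i - j)))"
    by (rule sum_mono2) auto
  also have "\<dots> = (\<Sum>j\<le>i. norm (u j))"
    by (rule sum.reindex_bij_witness[of _ "\<lambda>j. i - j" "\<lambda>j. i - j"]) auto
  also have "\<dots> \<le> l1_norm u"
    unfolding l1_norm_def using assms by (intro sum_le_suminf) auto
  finally show "(\<Sum>j<n. norm (shift j u i)) \<le> l1_norm u" .
qed

lemma entry_norm_lower_toep_mult:
  assumes "l1 u" "A \<in> carrier_mat n m"
  shows "entry_norm (lower_toep n u * A) \<le> l1_norm u * entry_norm A"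
  using assms sum_norm_shift_le[OF assms(1)]
  by (intro entry_norm_mult_left) (auto simp: lower_toep_def)

lemma entry_norm_upper_toep_mult:
  assumes "l1 u" "A \<in> carrier_mat n m"
  shows "entry_norm (upper_toep n u * A) \<le> l1_norm u * entry_norm A"
  using assms sum_norm_shift_le[OF assms(1)]
  by (intro entry_norm_mult_left) (auto simp: upper_toep_def)

lemma entry_norm_mult_upper_toep:
  assumes "l1 u" "A \<in> carrier_mat n m"
  shows "entry_norm (A * upper_toep m u) \<le> l1_norm u * entry_norm A"
  using assms sum_norm_shift_le[OF assms(1)]
  by (intro entry_norm_mult_right) (auto simp: upper_toep_def)

section \<open>Asymptotic multiplicativity\<close>

text \<open>The bound has no constant factor: binomial coefficients with upper argument between -1
  and 1 are at most 1 in absolute value. All l1 norms of such sequences are then at most 1 / (1 -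
  r).\<close>

definition geometric :: "real \<Rightarrow> (nat \<Rightarrow> complex) \<Rightarrow> bool" where
  "geometric r u \<longleftrightarrow> (\<forall>n. norm (u n) \<le> r ^ n)"

text \<open>The symbol is the product of the analytic factor \<open>u\<close> in z and the
  antianalytic factor \<open>v\<close> in 1/z, with reciprocals \<open>u'\<close> and
  \<open>v'\<close>. Normalizing the constant terms gives the triangular matrices determinant
  1.\<close>

locale toeplitz_symbol =
  fixes r :: real and u u' v v' :: "nat \<Rightarrow> complex"
  assumes r: "0 \<le> r" "r < 1"
    and geo: "geometric r u" "geometric r u'" "geometric r v" "geometric r v'"
    and inv: "conv u u' = unit_seq" "conv v v' = unit_seq"
    and init: "u 0 = 1" "v 0 = 1"
begin

lemma
  assumes "geometric r x"
  shows geometric_l1: "l1 x" and geometric_l1_norm: "l1_norm x \<le> 1 / (1 - r)"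
proof -
  have le: "norm (x n) \<le> r ^ n" for n
    using assms by (simp add: geometric_def)
  show l1: "l1 x"
    using r le by (intro summable_comparison_test[OF _ summable_geometric[of r]]) auto
  show "l1_norm x \<le> 1 / (1 - r)"
    unfolding l1_norm_def using suminf_le[OF le l1 summable_geometric] suminf_geometric[of r] r by simp
qed

lemmas l1s = geometric_l1[OF geo(1)] geometric_l1[OF geo(2)] geometric_l1[OF geo(3)] geometric_l1[OF geo(4)]
lemmas l1_norms = geometric_l1_norm[OF geo(1)] geometric_l1_norm[OF geo(2)]
  geometric_l1_norm[OF geo(3)] geometric_l1_norm[OF geo(4)]

lemma init': "u' 0 = 1" "v' 0 = 1"
  using conv_0[of u u'] conv_0[of v v'] inv init by (simp_all add: unit_seq_def)

lemma sum_power_le: "(\<Sum>i<n. r ^ i) \<le> 1 / (1 - r)"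
  using sum_le_suminf[OF summable_geometric[of r], of "{..<n}"] suminf_geometric[of r] r by simp

lemma norm_hank_entry_le: "norm (hank_entry u v i j) \<le> r ^ (i + j) / (1 - r)"
proof -
  have le: "norm (u (i + Suc m) * v (j + Suc m)) \<le> r ^ (i + j) * r ^ m" for m
  proof -
    have "norm (u (i + Suc m) * v (j + Suc m)) \<le> r ^ (i + Suc m) * r ^ (j + Suc m)"
      unfolding norm_mult using geo r by (intro mult_mono) (auto simp: geometric_def simp del: power_Suc)
    also have "\<dots> = r ^ (i + j + m + (m + 2))"
      by (simp flip: power_add add: ac_simps)
    also have "\<dots> \<le> r ^ (i + j + m)"
      using r by (intro power_decreasing) auto
    finally show ?thesis by (simp add: power_add)
  qed
  have "norm (hank_entry u v i j) \<le> (\<Sum>m. r ^ (i + j) * r ^ m)"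
    unfolding hank_entry_def using r by (intro norm_suminf_le le summable_mult summable_geometric) auto
  then show ?thesis
    using r by (simp add: suminf_mult suminf_geometric summable_geometric)
qed

definition remainder :: "nat \<Rightarrow> complex mat" where
  "remainder n = lower_toep n u' * hank n u v * upper_toep n v'"

lemma remainder_carrier [simp]: "remainder n \<in> carrier_mat n n"
  unfolding remainder_def by (meson mult_carrier_mat toep_carrier)

lemma dim_remainder [simp]: "dim_row (remainder n) = n" "dim_col (remainder n) = n"
  using carrier_matD[OF remainder_carrier] by auto

text \<open>Three of the five factors bound the Hankel matrix, one for its inner series and one for
  each matrix index; the other two bound the triangular factors.\<close>

lemma entry_norm_remainder: "entry_norm (remainder n) \<le> (1 / (1 - r)) ^ 5"
proof -
  define S where "S = 1 / (1 - r)"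
  have S: "S \<ge> 0" using r by (simp add: S_def)
  have "entry_norm (hank n u v) \<le> (\<Sum>i<n. \<Sum>j<n. S * (r ^ i * r ^ j))"
    unfolding entry_norm_def hank_def using norm_hank_entry_le
    by (auto intro!: sum_mono simp: S_def power_add)
  also have "\<dots> = S * ((\<Sum>i<n. r ^ i) * (\<Sum>j<n. r ^ j))"
    by (simp add: sum_distrib_left[symmetric] sum_distrib_right[symmetric])
  also have "\<dots> \<le> S * (S * S)"
    unfolding S_def using r by (intro mult_left_mono mult_mono sum_power_le) (auto intro: sum_nonneg)
  finally have H: "entry_norm (hank n u v) \<le> S * (S * S)" .
  have "entry_norm (remainder n) \<le> l1_norm v' * entry_norm (lower_toep n u' * hank n u v)"
    unfolding remainder_def using l1s
    by (intro entry_norm_mult_upper_toep[where n = n]) (auto simp: mult_carrier_mat[of _ n n _ n])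
  also have "\<dots> \<le> l1_norm v' * (l1_norm u' * entry_norm (hank n u v))"
    using l1s by (intro mult_left_mono entry_norm_lower_toep_mult[where m = n] l1_norm_nonneg) auto
  also have "\<dots> \<le> S * (S * (S * (S * S)))"
    using l1s l1_norms S H by (intro mult_mono l1_norm_nonneg mult_nonneg_nonneg entry_norm_nonneg) (auto simp: S_def)
  finally show ?thesis
    by (simp add: S_def eval_nat_numeral)
qed

lemma toep_conj: "lower_toep n u' * toep n u v * upper_toep n v' = 1\<^sub>m n + remainder n"
proof -
  note assoc = assoc_mult_mat[of _ n n _ n _ n]
  have L: "lower_toep n u' * lower_toep n u = 1\<^sub>m n" and U: "upper_toep n v * upper_toep n v' = 1\<^sub>m n"
    using inv by (simp_all add: lower_toep_conv upper_toep_conv conv_commute[of u'] toep_unit_seq)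
  have "lower_toep n u' * toep n u v * upper_toep n v' =
      lower_toep n u' * (lower_toep n u * upper_toep n v) * upper_toep n v' + remainder n"
    unfolding remainder_def toep_decomp[OF l1s(1,3)]
    by (subst mult_add_distrib_mat[of _ n n _ n], simp, meson mult_carrier_mat toep_carrier, simp,
        subst add_mult_distrib_mat[of _ n n _ _ n]) (auto intro!: mult_carrier_mat[of _ n n])
  also have "lower_toep n u' * (lower_toep n u * upper_toep n v) * upper_toep n v' =
      (lower_toep n u' * lower_toep n u) * (upper_toep n v * upper_toep n v')"
    by (simp add: assoc mult_carrier_mat[of _ n n])
  finally show ?thesis
    by (simp add: L U)
qed

lemma det_conj:
  assumes "A \<in> carrier_mat n n"
  shows "det (lower_toep n u' * A * upper_toep n v') = det A"
  using assms init'
  by (simp add: det_mult[of _ n] mult_carrier_mat[of _ n n] det_lower_toep det_upper_toep)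

text \<open>The identity \<open>upper_toep n v' * upper_toep n v\<close> is inserted in front of
  \<open>Y\<close>. After this, both factors of the main term are the identity plus a matrix of
  bounded \<open>entry_norm\<close> as soon as \<open>Y\<close> is one.\<close>

lemma toep_conj_mult:
  assumes Y: "Y \<in> carrier_mat n n" and Z: "Z \<in> carrier_mat n n"
  shows "lower_toep n u' * (toep n u v * Y + Z) * upper_toep n v' =
    (1\<^sub>m n + remainder n) * (upper_toep n v * Y * upper_toep n v') + lower_toep n u' * Z * upper_toep n v'"
proof -
  note assoc = assoc_mult_mat[of _ n n _ n _ n] and carr = mult_carrier_mat[of _ n n _ n]
  have V: "upper_toep n v' * (upper_toep n v * X) = X" if "X \<in> carrier_mat n n" for X
    using inv that by (simp flip: assoc add: upper_toep_conv conv_commute[of v'] toep_unit_seq)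
  have "lower_toep n u' * (toep n u v * Y + Z) * upper_toep n v' =
      lower_toep n u' * (toep n u v * Y) * upper_toep n v' + lower_toep n u' * Z * upper_toep n v'"
    using Y Z by (simp add: mult_add_distrib_mat[of _ n n _ n] add_mult_distrib_mat[of _ n n _ _ n] carr)
  also have "lower_toep n u' * (toep n u v * Y) * upper_toep n v' =
      (1\<^sub>m n + remainder n) * (upper_toep n v * Y * upper_toep n v')"
    unfolding toep_conj[symmetric] using Y by (simp add: assoc carr V)
  finally show ?thesis .
qed

text \<open>Conjugation by triangular matrices of determinant 1 preserves all determinants and turns
  the matrix into P Q + E, with P Q at bounded distance from the identity and E tending to 0. The
  lemma serves both the multiplicativity of Toeplitz determinants and the treatment of the
  border.\<close>

lemma det_toep_perturb:
  assumes Y: "\<And>n. Y n \<in> carrier_mat n n" and Z: "\<And>n. Z n \<in> carrier_mat n n"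
    and Y1: "\<And>n. entry_norm (Y n - 1\<^sub>m n) \<le> C"
    and Z0: "(\<lambda>n. entry_norm (Z n)) \<longlonglongrightarrow> 0"
  shows "(\<lambda>n. det (toep n u v * Y n + Z n) - det (toep n u v) * det (Y n)) \<longlonglongrightarrow> 0"
proof (rule Lim_null_comparison)
  define S where "S = 1 / (1 - r)"
  \<comment> \<open>The constant bounds P Q - 1 = K + (Q - 1) + K (Q - 1), where K is the remainder,
    P = 1 + K, and Q is the conjugate of \<open>Y n\<close>.\<close>
  define c where "c = S ^ 5 + S * (S * C) + S ^ 5 * (S * (S * C))"
  have S: "S \<ge> 0" using r by (simp add: S_def)
  have C: "C \<ge> 0" using Y1[of 0] entry_norm_nonneg order_trans by blast
  show "\<forall>\<^sub>F n in sequentially. norm (det (toep n u v * Y n + Z n) - det (toep n u v) * det (Y n))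
      \<le> exp c * (exp (S * (S * entry_norm (Z n))) - 1)"
  proof (rule always_eventually, rule allI)
    fix n
    note carr = mult_carrier_mat[of _ n n _ n]
    define P where "P = 1\<^sub>m n + remainder n"
    define Q where "Q = upper_toep n v * Y n * upper_toep n v'"
    define E where "E = lower_toep n u' * Z n * upper_toep n v'"
    have P: "P \<in> carrier_mat n n" and Q: "Q \<in> carrier_mat n n" and E: "E \<in> carrier_mat n n"
      using Y[of n] Z[of n] by (auto simp: P_def Q_def E_def carr)
    have detA: "det (toep n u v * Y n + Z n) = det (P * Q + E)"
      using det_conj[of "toep n u v * Y n + Z n" n] Y[of n] Z[of n]
      by (simp add: toep_conj_mult carr P_def Q_def E_def)
    have detT: "det (toep n u v) = det P"
      using det_conj[of "toep n u v" n] by (simp add: toep_conj P_def)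
    have detY: "det (Y n) = det Q"
      using Y[of n] init init'
      by (simp add: Q_def det_mult[of _ n] carr det_upper_toep)
    have "Q - 1\<^sub>m n = upper_toep n v * (Y n - 1\<^sub>m n) * upper_toep n v'"
    proof -
      have "upper_toep n v * upper_toep n v' = 1\<^sub>m n"
        using inv by (simp add: upper_toep_conv toep_unit_seq)
      then show ?thesis
        using Y[of n]
        by (simp add: Q_def mult_minus_distrib_mat[of _ n n _ n] minus_mult_distrib_mat[of _ n n _ _ n]
            right_mult_one_mat[of _ n n] carr)
    qed
    also have "entry_norm \<dots> \<le> l1_norm v' * entry_norm (upper_toep n v * (Y n - 1\<^sub>m n))"
      using l1s Y[of n] by (intro entry_norm_mult_upper_toep) (auto simp: carr)
    also have "\<dots> \<le> l1_norm v' * (l1_norm v * entry_norm (Y n - 1\<^sub>m n))"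
      using l1s Y[of n] by (intro mult_left_mono entry_norm_upper_toep_mult l1_norm_nonneg) auto
    also have "\<dots> \<le> S * (S * C)"
      using l1s l1_norms Y1[of n] S
      by (intro mult_mono l1_norm_nonneg mult_nonneg_nonneg entry_norm_nonneg) (auto simp: S_def)
    finally have q: "entry_norm (Q - 1\<^sub>m n) \<le> S * (S * C)" .
    have "entry_norm E \<le> l1_norm v' * entry_norm (lower_toep n u' * Z n)"
      unfolding E_def using l1s Z[of n] by (intro entry_norm_mult_upper_toep) (auto simp: carr)
    also have "\<dots> \<le> l1_norm v' * (l1_norm u' * entry_norm (Z n))"
      using l1s Z[of n] by (intro mult_left_mono entry_norm_lower_toep_mult[where m = n] l1_norm_nonneg) auto
    also have "\<dots> \<le> S * (S * entry_norm (Z n))"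
      using l1s l1_norms S
      by (intro mult_mono l1_norm_nonneg mult_nonneg_nonneg entry_norm_nonneg) (auto simp: S_def)
    finally have e: "entry_norm E \<le> S * (S * entry_norm (Z n))" .
    have k: "entry_norm (remainder n) \<le> S ^ 5"
      using entry_norm_remainder by (simp add: S_def)
    have "P * Q - 1\<^sub>m n = (remainder n + (Q - 1\<^sub>m n)) + remainder n * (Q - 1\<^sub>m n)"
    proof -
      have "P * Q = Q + remainder n * Q"
        unfolding P_def using Q by (simp add: add_mult_distrib_mat[of _ n n _ _ n])
      moreover have "remainder n * (Q - 1\<^sub>m n) = remainder n * Q - remainder n"
        using Q by (simp add: mult_minus_distrib_mat[of _ n n _ n])
      moreover have "remainder n * Q \<in> carrier_mat n n" using Q by (simp add: carr)
      ultimately show ?thesis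
        using Q by (intro eq_matI) auto
    qed
    also have "entry_norm \<dots> \<le> (entry_norm (remainder n) + entry_norm (Q - 1\<^sub>m n))
        + entry_norm (remainder n) * entry_norm (Q - 1\<^sub>m n)"
      using Q by (intro order_trans[OF entry_norm_triangle[of _ n n]] add_mono
        entry_norm_triangle[of _ n n] entry_norm_mult[of _ n]) (auto simp: carr)
    also have "\<dots> \<le> c"
      unfolding c_def using q k S C by (intro add_mono mult_mono entry_norm_nonneg) auto
    finally have pq: "entry_norm (P * Q - 1\<^sub>m n) \<le> c" .
    have "P * Q + E - P * Q = E"
      using P Q E by (intro eq_matI) auto
    then have "norm (det (P * Q + E) - det (P * Q)) \<le> exp (entry_norm (P * Q - 1\<^sub>m n)) * (exp (entry_norm E) - 1)"
      using norm_det_diff_le[of "P * Q + E" n "P * Q"] P Q E by (simp add: carr)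
    also have "\<dots> \<le> exp c * (exp (S * (S * entry_norm (Z n))) - 1)"
      using pq e entry_norm_nonneg[of E] by (intro mult_mono) auto
    finally show "norm (det (toep n u v * Y n + Z n) - det (toep n u v) * det (Y n))
        \<le> exp c * (exp (S * (S * entry_norm (Z n))) - 1)"
      using P Q by (simp add: detA detT detY det_mult[of _ n])
  qed
  show "(\<lambda>n. exp c * (exp (S * (S * entry_norm (Z n))) - 1)) \<longlonglongrightarrow> 0"
    by (rule tendsto_eq_intros Z0 refl | simp)+
qed

lemma norm_det_toep_le: "norm (det (toep n u v)) \<le> exp ((1 / (1 - r)) ^ 5)"
proof -
  have "det (toep n u v) = det (1\<^sub>m n + remainder n)"
    using det_conj[of "toep n u v" n] by (simp add: toep_conj)
  moreover have "1\<^sub>m n + remainder n - 1\<^sub>m n = remainder n"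
    by (intro eq_matI) auto
  ultimately show ?thesis
    using norm_det_le[of "1\<^sub>m n + remainder n" n] entry_norm_remainder[of n]
      order_trans exp_le_cancel_iff by fastforce
qed

end

text \<open>The linear factor accommodates entries that are sums of p + 1 terms of the same
  geometric size, as they occur in the columns of the next proof.\<close>

lemma l1_norm_tail_linear_geometric_le:
  assumes r: "0 \<le> r" "r < 1" and x: "l1 x" and B: "B \<ge> 0"
    and le: "\<And>p. p \<ge> n \<Longrightarrow> norm (x p) \<le> B * (real (Suc p) * r ^ p)"
  shows "l1_norm (tail n x) \<le> B * (\<Sum>p. real (Suc (p + n)) * r ^ (p + n))"
proof -
  have s: "summable (\<lambda>p. real (Suc p) * r ^ p)"
    using geometric_deriv_sums[of r] r by (auto simp: sums_iff)
  then have s': "summable (\<lambda>p. real (Suc (p + n)) * r ^ (p + n))"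
    by (rule summable_ignore_initial_segment)
  have "l1_norm (tail n x) \<le> (\<Sum>p. B * (real (Suc (p + n)) * r ^ (p + n)))"
    unfolding l1_norm_tail[OF x]
  proof (rule suminf_le)
    show "norm (x (p + n)) \<le> B * (real (Suc (p + n)) * r ^ (p + n))" for p
      by (rule le) simp
  qed (rule summable_ignore_initial_segment[OF x], rule summable_mult[OF s'])
  then show ?thesis
    using s' by (simp only: suminf_mult)
qed

text \<open>For infinite matrices the operator with factors \<open>u\<close>,
  \<open>conv v w\<close> equals the one with factors \<open>u\<close>, \<open>v\<close> applied to
  the columns \<open>y j\<close>. These columns are nearly supported on indices up to
  \<open>j\<close>, so truncation to size \<open>n\<close> costs an error tending to 0.\<close>

lemma det_toep_conv:
  assumes v: "toeplitz_symbol r u u' v v'" and w: "toeplitz_symbol r u u' w w'"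
  shows "(\<lambda>n. det (toep n u (conv v w)) - det (toep n u v) * det (toep n u w)) \<longlonglongrightarrow> 0"
proof -
  interpret v: toeplitz_symbol r u u' v v' by (rule v)
  interpret w: toeplitz_symbol r u u' w w' by (rule w)
  note r = v.r and l1s = v.l1s w.l1s
  define S where "S = 1 / (1 - r)"
  have S: "S \<ge> 0" using r by (simp add: S_def)
  \<comment> \<open>This is column \<open>j\<close> of the infinite Toeplitz matrix of
    \<open>u\<close>, \<open>w\<close>, multiplied from the left by the inverse of its lower
    triangular factor.\<close>
  define y where "y j = conv u' (corr w (shift j u))" for j
  have l1_col: "l1 (corr w (shift j u))" for j
    using l1s by (intro l1_corr l1_shift)
  have l1_y: "l1 (y j)" for j
    unfolding y_def using l1s l1_col by (intro l1_conv)
  have conv_y: "conv u (y j) = corr w (shift j u)" for j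
    by (simp add: y_def flip: conv_assoc add: v.inv)
  have y_eq: "(lower_toep n u' * toep n u w) $$ (p, j) = y j p" if "p < n" "j < n" for n p j
  proof -
    have "(lower_toep n u' * toep n u w) $$ (p, j) = (\<Sum>m<n. shift m u' p * toep_entry u w m j)"
      using that by (simp add: lower_toep_def toep_def scalar_prod_def lessThan_atLeast0)
    also have "\<dots> = (\<Sum>m\<le>p. u' (p - m) * toep_entry u w m j)"
      using that by (intro sum.mono_neutral_cong_right) (auto simp: shift_def)
    finally show ?thesis
      by (simp add: y_def conv_def toep_entry_def)
  qed
  have y_le: "norm (y j p) \<le> S * r ^ j * (real (Suc p) * r ^ p)" if "j < p" for j p
  proof -
    \<comment> \<open>Below the diagonal the upper triangular part vanishes and only the Hankel part
      contributes. Size p + 1 is the smallest that contains the entry, whose value is the same for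
      all larger sizes.\<close>
    let ?n = "Suc p"
    note carr = mult_carrier_mat[of _ ?n ?n _ ?n]
    have "lower_toep ?n u' * toep ?n u w = upper_toep ?n w + lower_toep ?n u' * hank ?n u w"
      unfolding toep_decomp[OF l1s(1) l1s(7)]
      by (simp add: mult_add_distrib_mat[of _ ?n ?n _ ?n] carr v.inv lower_toep_conv conv_commute[of u'] toep_unit_seq
          left_mult_one_mat[of _ ?n ?n] flip: assoc_mult_mat[of _ ?n ?n _ ?n _ ?n])
    then have "y j p = (upper_toep ?n w + lower_toep ?n u' * hank ?n u w) $$ (p, j)"
      using y_eq[of p ?n j] that by simp
    also have "\<dots> = (\<Sum>m<?n. shift m u' p * hank_entry u w m j)"
      using that by (simp add: upper_toep_def lower_toep_def hank_def scalar_prod_def lessThan_atLeast0 shift_def)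
    finally have "norm (y j p) \<le> (\<Sum>m<?n. norm (shift m u' p * hank_entry u w m j))"
      by (simp only: norm_sum)
    also have "\<dots> \<le> (\<Sum>m<?n. S * r ^ j * r ^ p)"
    proof (rule sum_mono)
      fix m assume "m \<in> {..<?n}"
      then have m: "m \<le> p" by simp
      have "norm (shift m u' p * hank_entry u w m j) \<le> r ^ (p - m) * (r ^ (m + j) * S)"
        unfolding norm_mult using w.norm_hank_entry_le[of m j] v.geo(2) m r
        by (intro mult_mono) (auto simp: S_def geometric_def shift_def)
      also have "\<dots> = r ^ (p - m + m) * S * r ^ j"
        by (simp only: power_add mult_ac)
      finally show "norm (shift m u' p * hank_entry u w m j) \<le> S * r ^ j * r ^ p"
        using m by (simp add: mult_ac)
    qed
    finally show ?thesis
      by (simp add: mult_ac)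
  qed
  define \<tau> where "\<tau> n = (\<Sum>p. real (Suc (p + n)) * r ^ (p + n))" for n
  have \<tau>: "\<tau> \<longlonglongrightarrow> 0"
    unfolding \<tau>_def using geometric_deriv_sums[of r] r
    by (intro suminf_exist_split2) (auto simp: sums_iff)
  define Z' where "Z' n = Matrix.mat n n (\<lambda>(i, j). corr v (conv u (tail n (y j))) i)" for n
  have Z'[simp]: "Z' n \<in> carrier_mat n n" for n by (simp add: Z'_def)
  have toep_eq: "toep n u (conv v w) = toep n u v * (lower_toep n u' * toep n u w) + Z' n" for n
  proof (rule eq_matI)
    fix i j
    assume "i < dim_row (toep n u v * (lower_toep n u' * toep n u w) + Z' n)"
      "j < dim_col (toep n u v * (lower_toep n u' * toep n u w) + Z' n)"
    then have ij: "i < n" "j < n" by (auto simp: Z'_def)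
    have "toep_entry u (conv v w) i j = corr v (conv u (y j)) i"
      unfolding toep_entry_def conv_y using l1s by (simp add: corr_corr l1_shift)
    also have "\<dots> = (\<Sum>p<n. toep_entry u v i p * y j p) + corr v (conv u (tail n (y j))) i"
      using l1s l1_y by (intro corr_conv_split)
    also have "(\<Sum>p<n. toep_entry u v i p * y j p) = (toep n u v * (lower_toep n u' * toep n u w)) $$ (i, j)"
    proof -
      have "(toep n u v * (lower_toep n u' * toep n u w)) $$ (i, j)
          = (\<Sum>p<n. toep n u v $$ (i, p) * (lower_toep n u' * toep n u w) $$ (p, j))"
        using ij carrier_matD[OF toep_carrier(1)[of n u']] carrier_matD[OF toep_carrier(3)[of n u v]]
          carrier_matD[OF toep_carrier(3)[of n u w]]
        by (simp add: scalar_prod_def lessThan_atLeast0 del: index_mult_mat(1) add: index_mult_mat(1)[of i "toep n u v"])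
      also have "\<dots> = (\<Sum>p<n. toep_entry u v i p * y j p)"
        using ij y_eq[of _ n j] by (intro sum.cong) (auto simp: toep_def simp del: index_mult_mat)
      finally show ?thesis ..
    qed
    finally show "toep n u (conv v w) $$ (i, j) = (toep n u v * (lower_toep n u' * toep n u w) + Z' n) $$ (i, j)"
      using ij by (simp add: toep_def Z'_def)
  qed (auto simp: Z'_def toep_def)
  have Z'_le: "entry_norm (Z' n) \<le> S * S * S * S * \<tau> n" for n
  proof -
    have tau_nn: "0 \<le> \<tau> n"
      unfolding \<tau>_def using geometric_deriv_sums[of r] r
      by (intro suminf_nonneg summable_ignore_initial_segment) (auto simp: sums_iff)
    have "entry_norm (Z' n) = (\<Sum>j<n. \<Sum>i<n. norm (corr v (conv u (tail n (y j))) i))"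
      unfolding entry_norm_def by (subst sum.swap) (simp add: Z'_def)
    also have "\<dots> \<le> (\<Sum>j<n. S * (S * (S * r ^ j * \<tau> n)))"
    proof (rule sum_mono)
      fix j assume "j \<in> {..<n}"
      then have t: "l1_norm (tail n (y j)) \<le> S * r ^ j * \<tau> n"
        unfolding \<tau>_def using r S y_le l1_y
        by (intro l1_norm_tail_linear_geometric_le) auto
      have "(\<Sum>i<n. norm (corr v (conv u (tail n (y j))) i)) \<le> l1_norm v * l1_norm (conv u (tail n (y j)))"
        using l1s l1_y by (intro sum_norm_corr_le l1_conv l1_tail)
      also have "\<dots> \<le> l1_norm v * (l1_norm u * l1_norm (tail n (y j)))"
        using l1s l1_y by (intro mult_left_mono l1_norm_conv l1_norm_nonneg l1_tail)
      also have "\<dots> \<le> S * (S * (S * r ^ j * \<tau> n))"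
        using l1s v.l1_norms S t l1_y
        by (intro mult_mono mult_nonneg_nonneg l1_norm_nonneg l1_tail) (auto simp: S_def)
      finally show "(\<Sum>i<n. norm (corr v (conv u (tail n (y j))) i)) \<le> S * (S * (S * r ^ j * \<tau> n))" .
    qed
    \<comment> \<open>The factor \<open>r ^ j\<close> keeps the sum over all columns bounded, so the
      error is of the order of \<open>\<tau> n\<close>.\<close>
    also have "\<dots> = S * S * S * \<tau> n * (\<Sum>j<n. r ^ j)"
      by (simp add: sum_distrib_left mult_ac)
    also have "\<dots> \<le> S * S * S * \<tau> n * S"
      unfolding S_def using r tau_nn by (intro mult_left_mono v.sum_power_le) auto
    finally show ?thesis by (simp add: mult_ac)
  qed
  \<comment> \<open>Multiplying by \<open>upper_toep n w'\<close>, of determinant 1, removes the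
    upper triangular factor and leaves a matrix that differs from the identity by the remainder for
    \<open>w\<close>.\<close>
  define Y where "Y n = lower_toep n u' * toep n u w * upper_toep n w'" for n
  define Z where "Z n = Z' n * upper_toep n w'" for n
  have carr: "Y n \<in> carrier_mat n n" "Z n \<in> carrier_mat n n" for n
    by (auto simp: Y_def Z_def mult_carrier_mat[of _ n n _ n])
  have "(\<lambda>n. det (toep n u v * Y n + Z n) - det (toep n u v) * det (Y n)) \<longlonglongrightarrow> 0"
  proof (rule v.det_toep_perturb[OF carr])
    show "entry_norm (Y n - 1\<^sub>m n) \<le> (1 / (1 - r)) ^ 5" for n
    proof -
      have "Y n - 1\<^sub>m n = w.remainder n"
        unfolding Y_def w.toep_conj by (intro eq_matI) auto
      then show ?thesis using w.entry_norm_remainder by simp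
    qed
    have le: "entry_norm (Z n) \<le> S * (S * S * S * S * \<tau> n)" for n
    proof -
      have "entry_norm (Z n) \<le> l1_norm w' * entry_norm (Z' n)"
        unfolding Z_def using l1s by (intro entry_norm_mult_upper_toep[where n = n]) auto
      also have "\<dots> \<le> S * (S * S * S * S * \<tau> n)"
        using w.l1_norms S Z'_le by (intro mult_mono entry_norm_nonneg) (auto simp: S_def)
      finally show ?thesis .
    qed
    show "(\<lambda>n. entry_norm (Z n)) \<longlonglongrightarrow> 0"
    proof (rule Lim_null_comparison)
      show "\<forall>\<^sub>F n in sequentially. norm (entry_norm (Z n)) \<le> S * (S * S * S * S * \<tau> n)"
        using le entry_norm_nonneg by (simp add: always_eventually)
      show "(\<lambda>n. S * (S * S * S * S * \<tau> n)) \<longlonglongrightarrow> 0"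
        by (rule tendsto_eq_intros \<tau> refl | simp)+
    qed
  qed
  moreover have "det (toep n u v * Y n + Z n) = det (toep n u (conv v w))" for n
  proof -
    note carr = mult_carrier_mat[of _ n n _ n]
    have "toep n u v * Y n + Z n = toep n u (conv v w) * upper_toep n w'"
      unfolding toep_eq Y_def Z_def
      by (simp add: add_mult_distrib_mat[of _ n n _ _ n] carr assoc_mult_mat[of _ n n _ n _ n])
    then show ?thesis
      using w.init' by (simp add: det_mult[of _ n] det_upper_toep)
  qed
  moreover have "det (Y n) = det (toep n u w)" for n
    unfolding Y_def by (intro w.det_conj) simp
  ultimately show ?thesis by simp
qed

lemma det_toep_swap:
  assumes "l1 u" "l1 v"
  shows "det (toep n v u) = det (toep n u v)"
  unfolding toep_swap[OF assms] by (intro det_transpose[of _ n]) simp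

section \<open>The Toeplitz determinants of binomial symbols\<close>

text \<open>The power series coefficients of (1 - a z) to the power \<open>\<alpha>\<close>.\<close>

definition bin :: "real \<Rightarrow> real \<Rightarrow> nat \<Rightarrow> complex" where
  "bin a \<alpha> n = complex_of_real ((\<alpha> gchoose n) * (- a) ^ n)"

lemma bin_0 [simp]: "bin a \<alpha> 0 = 1"
  by (simp add: bin_def)

lemma gbinomial_Suc_rec: "(\<alpha> gchoose Suc n) = (\<alpha> - real n) / real (Suc n) * (\<alpha> gchoose n)"
  using gbinomial_mult_1[of \<alpha> n] by (simp add: field_simps)

lemma abs_gbinomial_le_1:
  assumes "\<bar>\<alpha>\<bar> \<le> (1 :: real)"
  shows "\<bar>\<alpha> gchoose n\<bar> \<le> 1"
proof (induction n)
  case (Suc n)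
  have "\<bar>(\<alpha> - real n) / real (Suc n)\<bar> \<le> 1"
    using assms by (simp add: abs_le_iff divide_simps)
  then show ?case
    using mult_mono[OF _ Suc.IH, of "\<bar>(\<alpha> - real n) / real (Suc n)\<bar>" 1]
    unfolding gbinomial_Suc_rec abs_mult by simp
qed simp

lemma geometric_bin:
  assumes "0 \<le> a" "\<bar>\<alpha>\<bar> \<le> 1"
  shows "geometric a (bin a \<alpha>)"
  unfolding geometric_def
proof
  fix n
  show "norm (bin a \<alpha> n) \<le> a ^ n"
    using assms mult_right_mono[OF abs_gbinomial_le_1[OF assms(2), of n], of "a ^ n"]
    by (simp add: bin_def norm_mult norm_power)
qed

lemma conv_bin: "conv (bin a \<alpha>) (bin a \<beta>) = bin a (\<alpha> + \<beta>)"
proof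
  fix n
  have "conv (bin a \<alpha>) (bin a \<beta>) n = of_real (\<Sum>k\<le>n. (\<alpha> gchoose (n - k)) * (\<beta> gchoose k) * ((- a) ^ (n - k) * (- a) ^ k))"
    unfolding conv_def bin_def of_real_sum by (intro sum.cong refl) simp
  also have "(\<Sum>k\<le>n. (\<alpha> gchoose (n - k)) * (\<beta> gchoose k) * ((- a) ^ (n - k) * (- a) ^ k))
      = (\<Sum>k\<le>n. (\<beta> gchoose k) * (\<alpha> gchoose (n - k))) * (- a) ^ n"
    unfolding sum_distrib_right by (intro sum.cong refl) (simp flip: power_add)
  also have "\<dots> = ((\<alpha> + \<beta>) gchoose n) * (- a) ^ n"
    using gbinomial_Vandermonde[of \<beta> \<alpha> n] by (simp add: atMost_atLeast0 add.commute)
  finally show "conv (bin a \<alpha>) (bin a \<beta>) n = bin a (\<alpha> + \<beta>) n"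
    by (simp only: bin_def[of a "\<alpha> + \<beta>"])
qed

lemma bin_zero: "bin a 0 = unit_seq"
  by (rule ext) (simp add: bin_def unit_seq_def gbinomial_0_left)

lemma toeplitz_symbol_bin:
  assumes "0 \<le> a" "a < 1" "\<bar>\<alpha>\<bar> \<le> 1" "\<bar>\<beta>\<bar> \<le> 1"
  shows "toeplitz_symbol a (bin a \<alpha>) (bin a (- \<alpha>)) (bin a \<beta>) (bin a (- \<beta>))"
  using assms by unfold_locales (simp_all add: geometric_bin conv_bin bin_zero)

text \<open>Here \<open>\<alpha>\<close> is the exponent of 1 - a z and \<open>\<beta>\<close> that
  of 1 - a / z.\<close>

definition dbin :: "real \<Rightarrow> nat \<Rightarrow> real \<Rightarrow> real \<Rightarrow> complex" where
  "dbin a n \<alpha> \<beta> = det (toep n (bin a \<alpha>) (bin a \<beta>))"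

lemma bin_minus_one: "bin a (- 1) n = of_real (a ^ n)"
proof -
  have "(- 1 gchoose n) = (- 1 :: real) ^ n"
  proof (induction n)
    case (Suc n)
    then show ?case by (simp add: gbinomial_Suc_rec field_simps)
  qed simp
  then show ?thesis
    by (simp add: bin_def flip: power_mult_distrib of_real_mult of_real_power)
qed

lemma bin_one: "bin a 1 n = (if n = 0 then 1 else if n = 1 then - of_real a else 0)"
proof -
  have "(1 gchoose Suc (Suc m) :: real) = 0" for m
    by (induction m) (simp_all add: gbinomial_Suc_rec)
  moreover obtain m where "n = Suc (Suc m)" if "n \<noteq> 0" "n \<noteq> 1"
    by (metis One_nat_def not0_implies_Suc)
  ultimately show ?thesis
    by (auto simp: bin_def)
qed

text \<open>As 1 - a / z has only two coefficients, the Hankel matrix is confined to column 0, where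
  it is a multiple of the geometric sequence. The triangular factor maps that sequence to the first
  unit vector, so the remainder lives in row 0 and the conjugated matrix is upper triangular with a
  single diagonal entry different from 1.\<close>

lemma det_bin_one:
  assumes a: "0 \<le> a" "a < 1" and n: "n \<ge> 1"
  shows "dbin a n (- 1) 1 = 1 - of_real a ^ 2"
proof -
  interpret toeplitz_symbol a "bin a (- 1)" "bin a 1" "bin a 1" "bin a (- 1)"
    using toeplitz_symbol_bin[OF a, of "-1" 1] by simp
  have H: "hank_entry (bin a (- 1)) (bin a 1) i j = (if j = 0 then - (of_real a ^ 2) * bin a (- 1) i else 0)" for i j
  proof -
    have "hank_entry (bin a (- 1)) (bin a 1) i j = (\<Sum>m\<in>{0}. bin a (- 1) (i + Suc m) * bin a 1 (j + Suc m))"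
      unfolding hank_entry_def by (rule suminf_finite) (auto simp: bin_one)
    then show ?thesis
      by (simp add: bin_one bin_minus_one power2_eq_square)
  qed
  have LH: "(lower_toep n (bin a 1) * hank n (bin a (- 1)) (bin a 1)) $$ (i, j)
      = (if i = 0 \<and> j = 0 then - (of_real a ^ 2) else 0)" if "i < n" "j < n" for i j
  proof -
    have "(lower_toep n (bin a 1) * hank n (bin a (- 1)) (bin a 1)) $$ (i, j)
        = (\<Sum>l<n. shift l (bin a 1) i * hank_entry (bin a (- 1)) (bin a 1) l j)"
      using that by (simp add: lower_toep_def hank_def scalar_prod_def lessThan_atLeast0)
    also have "\<dots> = (\<Sum>l\<le>i. bin a 1 (i - l) * hank_entry (bin a (- 1)) (bin a 1) l j)"
      using that by (intro sum.mono_neutral_cong_right) (auto simp: shift_def)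
    also have "\<dots> = (if j = 0 then - (of_real a ^ 2) * conv (bin a 1) (bin a (- 1)) i else 0)"
      by (simp add: H conv_def sum_distrib_left mult_ac)
    also have "\<dots> = (if i = 0 \<and> j = 0 then - (of_real a ^ 2) else 0)"
      by (simp add: conv_bin bin_zero unit_seq_def)
    finally show ?thesis .
  qed
  have R: "remainder n $$ (i, j) = (if i = 0 then - (of_real a ^ 2) * bin a (- 1) j else 0)"
    if ij: "i < n" "j < n" for i j
  proof -
    let ?M = "lower_toep n (bin a 1) * hank n (bin a (- 1)) (bin a 1)"
    have "remainder n $$ (i, j) = (\<Sum>l<n. ?M $$ (i, l) * upper_toep n (bin a (- 1)) $$ (l, j))"
      using ij carrier_matD[OF toep_carrier(1)[of n "bin a 1"]] carrier_matD[OF toep_carrier(2)[of n "bin a (-1)"]]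
        carrier_matD[OF toep_carrier(4)[of n "bin a (-1)" "bin a 1"]]
      by (simp add: remainder_def scalar_prod_def lessThan_atLeast0 del: index_mult_mat(1) add: index_mult_mat(1)[of i ?M])
    also have "\<dots> = (\<Sum>l<n. (if l = 0 then if i = 0 then - (of_real a ^ 2) * bin a (- 1) j else 0 else 0))"
      using ij LH[OF ij(1)] by (intro sum.cong) (auto simp: upper_toep_def shift_def simp del: index_mult_mat)
    finally show ?thesis
      using n by simp
  qed
  have "dbin a n (- 1) 1 = det (1\<^sub>m n + remainder n)"
    unfolding dbin_def using det_conj[of "toep n (bin a (- 1)) (bin a 1)" n] by (simp add: toep_conj)
  also have "\<dots> = prod_list (diag_mat (1\<^sub>m n + remainder n))"
    by (rule det_upper_triangular[where n = n]) (auto simp: R)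
  also have "\<dots> = (\<Prod>i\<in>{0..<n}. if i = 0 then 1 - of_real a ^ 2 else 1)"
    unfolding prod_list_diag_prod by (intro prod.cong) (auto simp: R)
  also have "\<dots> = 1 - of_real a ^ 2"
    using n by (simp add: prod.delta)
  finally show ?thesis .
qed

section \<open>Real values, symmetry and doubling of the exponents\<close>

lemma suminf_in_Reals:
  fixes f :: "nat \<Rightarrow> complex"
  assumes "summable f" "\<And>n. f n \<in> \<real>"
  shows "suminf f \<in> \<real>"
  using closed_complex_Reals assms by (intro closed_sequentially[OF _ _ summable_LIMSEQ]) auto

lemma dbin_in_Reals:
  assumes a: "0 \<le> a" "a < 1" and \<alpha>: "\<bar>\<alpha>\<bar> \<le> 1" and \<beta>: "\<bar>\<beta>\<bar> \<le> 1"
  shows "dbin a n \<alpha> \<beta> \<in> \<real>"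
proof -
  interpret toeplitz_symbol a "bin a \<alpha>" "bin a (- \<alpha>)" "bin a \<beta>" "bin a (- \<beta>)"
    using assms by (rule toeplitz_symbol_bin)
  have "toep_entry (bin a \<alpha>) (bin a \<beta>) i j \<in> \<real>" for i j
    unfolding toep_entry_def corr_def
    by (rule suminf_in_Reals[OF summable_norm_cancel[OF l1_summable_corr[OF l1s(3) l1_shift[OF l1s(1)]]]])
      (auto simp: bin_def shift_def simp del: of_real_mult intro!: Reals_mult)
  moreover have "p i < n" if "p permutes {0..<n}" "i < n" for p i
    using permutes_in_image[OF that(1), of i] that by simp
  ultimately show ?thesis
    unfolding dbin_def det_def'[OF toep_carrier(3)]
    by (intro sum_in_Reals Reals_mult prod_in_Reals) (auto simp: toep_def sign_def)
qed

lemma dbin_swap: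
  assumes "0 \<le> a" "a < 1" "\<bar>\<alpha>\<bar> \<le> 1" "\<bar>\<beta>\<bar> \<le> 1"
  shows "dbin a n \<beta> \<alpha> = dbin a n \<alpha> \<beta>"
proof -
  interpret toeplitz_symbol a "bin a \<alpha>" "bin a (- \<alpha>)" "bin a \<beta>" "bin a (- \<beta>)"
    using assms by (rule toeplitz_symbol_bin)
  show ?thesis
    unfolding dbin_def using l1s by (intro det_toep_swap)
qed

lemma dbin_double:
  assumes "0 \<le> a" "a < 1" "\<bar>\<alpha>\<bar> \<le> 1" "\<bar>\<beta>\<bar> \<le> 1"
  shows "(\<lambda>n. dbin a n \<alpha> (2 * \<beta>) - (dbin a n \<alpha> \<beta>)\<^sup>2) \<longlonglongrightarrow> 0"
  using det_toep_conv[OF toeplitz_symbol_bin[OF assms] toeplitz_symbol_bin[OF assms]]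
  by (simp add: dbin_def conv_bin power2_eq_square)

text \<open>The fourth powers determine the limit of the absolute values. Closeness to squares
  excludes negative values: eventually \<open>x n\<close> exceeds -c/2 while its absolute value
  exceeds c/2.\<close>

lemma LIMSEQ_fourth_root:
  fixes x y :: "nat \<Rightarrow> real"
  assumes x4: "(\<lambda>n. x n ^ 4) \<longlonglongrightarrow> L" and L: "L > 0" and xy: "(\<lambda>n. x n - (y n)\<^sup>2) \<longlonglongrightarrow> 0"
  shows "x \<longlonglongrightarrow> L powr (1 / 4)"
proof -
  define c where "c = root 4 L"
  have c: "c > 0" using L by (simp add: c_def)
  have "(\<lambda>n. \<bar>root 4 (x n ^ 4)\<bar>) \<longlonglongrightarrow> \<bar>root 4 L\<bar>"
    by (intro tendsto_rabs tendsto_real_root x4)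
  moreover have "\<bar>root 4 (x n ^ 4)\<bar> = \<bar>x n\<bar>" for n
    by (rule root_abs_power) simp
  ultimately have abs: "(\<lambda>n. \<bar>x n\<bar>) \<longlonglongrightarrow> c"
    using c by (simp only: c_def abs_of_pos)
  have "\<forall>\<^sub>F n in sequentially. \<bar>x n\<bar> > c / 2"
    using c by (intro order_tendstoD(1)[OF abs]) simp
  moreover have "\<forall>\<^sub>F n in sequentially. x n - (y n)\<^sup>2 > - (c / 2)"
    using c by (intro order_tendstoD(1)[OF xy]) simp
  ultimately have "\<forall>\<^sub>F n in sequentially. \<bar>x n\<bar> = x n"
  proof eventually_elim
    case (elim n)
    then show ?case
      using zero_le_power2[of "y n"] by (cases "x n \<ge> 0") (simp, linarith)
  qed
  then have "x \<longlonglongrightarrow> c"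
    using abs by (rule Lim_transform_eventually[rotated])
  then show ?thesis
    using L by (simp add: c_def root_powr_inverse)
qed

text \<open>The limit is multiplicative in each exponent, so its fourth power is the value for the
  exponents \<open>-1\<close> and \<open>1\<close>; being also a limit of squares of real numbers, it is nonnegative.\<close>

theorem dbin_half_tendsto:
  assumes a: "0 \<le> a" "a < 1"
  shows "(\<lambda>n. dbin a n (- 1 / 2) (1 / 2)) \<longlonglongrightarrow> of_real ((1 - a\<^sup>2) powr (1 / 4))"
proof -
  \<comment> \<open>\<open>A\<close> is the wanted sequence. Doubling one exponent leads to
    \<open>B\<close>, doubling the other to the explicitly known \<open>C\<close>; halving the
    second exponent of \<open>A\<close> leads to \<open>E\<close>, which settles the sign.\<close>
  define A where "A n = dbin a n (- 1 / 2) (1 / 2)" for n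
  define B where "B n = dbin a n (- 1 / 2) 1" for n
  define C where "C n = dbin a n (- 1) 1" for n
  define E where "E n = dbin a n (- 1 / 2) (1 / 4)" for n
  have AB: "(\<lambda>n. B n - (A n)\<^sup>2) \<longlonglongrightarrow> 0"
    using dbin_double[OF a, of "- 1 / 2" "1 / 2"] by (simp add: A_def B_def)
  have EA: "(\<lambda>n. A n - (E n)\<^sup>2) \<longlonglongrightarrow> 0"
    using dbin_double[OF a, of "- 1 / 2" "1 / 4"] by (simp add: A_def E_def)
  \<comment> \<open>Only the second exponent can be doubled directly; the first one is doubled after
    transposition.\<close>
  have BC: "(\<lambda>n. C n - (B n)\<^sup>2) \<longlonglongrightarrow> 0"
    using dbin_double[OF a, of 1 "- 1 / 2"] dbin_swap[OF a, of "- 1 / 2" 1] dbin_swap[OF a, of "- 1" 1]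
    by (simp add: B_def C_def)
  have "C \<longlonglongrightarrow> 1 - of_real a ^ 2"
    by (rule tendsto_eventually)
      (use a in \<open>auto simp: C_def det_bin_one intro!: eventually_sequentiallyI[of 1]\<close>)
  from tendsto_diff[OF this BC] have B2: "(\<lambda>n. (B n)\<^sup>2) \<longlonglongrightarrow> 1 - of_real a ^ 2"
    by simp
  interpret half: toeplitz_symbol a "bin a (- 1 / 2)" "bin a (1 / 2)" "bin a (1 / 2)" "bin a (- 1 / 2)"
    using toeplitz_symbol_bin[OF a, of "- 1 / 2" "1 / 2"] by simp
  define M where "M = exp ((1 / (1 - a)) ^ 5)"
  \<comment> \<open>The fourth power of A is B^2 - A^2 (B - A^2) - B (B - A^2). The uniform bounds
    on the determinants make the two correction terms tend to 0.\<close>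
  have "(\<lambda>n. (A n)\<^sup>2 * (B n - (A n)\<^sup>2)) \<longlonglongrightarrow> 0"
  proof (rule lim_null_mult_left_bounded[OF _ AB])
    have "norm ((A n)\<^sup>2) \<le> M\<^sup>2" for n
      using half.norm_det_toep_le[of n] by (simp add: A_def M_def dbin_def norm_power power_mono)
    then show "\<forall>\<^sub>F n in sequentially. norm ((A n)\<^sup>2) \<le> M\<^sup>2"
      by simp
  qed
  moreover have "(\<lambda>n. B n * (B n - (A n)\<^sup>2)) \<longlonglongrightarrow> 0"
  proof (rule lim_null_mult_left_bounded[OF _ AB])
    interpret toeplitz_symbol a "bin a (- 1 / 2)" "bin a (1 / 2)" "bin a 1" "bin a (- 1)"
      using toeplitz_symbol_bin[OF a, of "- 1 / 2" 1] by simp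
    show "\<forall>\<^sub>F n in sequentially. norm (B n) \<le> M"
      using norm_det_toep_le by (simp add: B_def M_def dbin_def)
  qed
  ultimately have "(\<lambda>n. (B n)\<^sup>2 - (A n)\<^sup>2 * (B n - (A n)\<^sup>2) - B n * (B n - (A n)\<^sup>2)) \<longlonglongrightarrow> (1 - of_real a ^ 2) - 0 - 0"
    by (intro tendsto_diff B2)
  then have A4: "(\<lambda>n. A n ^ 4) \<longlonglongrightarrow> of_real (1 - a\<^sup>2)"
    by (simp add: algebra_simps power2_eq_square eval_nat_numeral)
  have real: "A n = of_real (Re (A n))" "E n = of_real (Re (E n))" for n
    using dbin_in_Reals[OF a] by (auto simp: A_def E_def of_real_Re)
  have "(\<lambda>n. Re (A n)) \<longlonglongrightarrow> (1 - a\<^sup>2) powr (1 / 4)"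
  proof (rule LIMSEQ_fourth_root)
    have "(\<lambda>n. complex_of_real (Re (A n) ^ 4)) \<longlonglongrightarrow> of_real (1 - a\<^sup>2)"
      using A4 unfolding of_real_power real[symmetric] .
    then show "(\<lambda>n. Re (A n) ^ 4) \<longlonglongrightarrow> 1 - a\<^sup>2"
      by (subst (asm) tendsto_of_real_iff)
    have "(\<lambda>n. complex_of_real (Re (A n) - (Re (E n))\<^sup>2)) \<longlonglongrightarrow> of_real 0"
      using EA unfolding of_real_diff of_real_power real[symmetric] by simp
    then show "(\<lambda>n. Re (A n) - (Re (E n))\<^sup>2) \<longlonglongrightarrow> 0"
      by (subst (asm) tendsto_of_real_iff)
    show "1 - a\<^sup>2 > 0"
      using a by (simp add: power_less_one_iff)
  qed
  then have "(\<lambda>n. complex_of_real (Re (A n))) \<longlonglongrightarrow> of_real ((1 - a\<^sup>2) powr (1 / 4))"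
    by (rule tendsto_of_real)
  then show ?thesis
    unfolding real[symmetric] by (simp add: A_def)
qed

section \<open>Fourier coefficients of absolutely convergent series\<close>

text \<open>Finitely many points do not affect the contour integral. The exceptional set will absorb
  the removable singularity, which can lie on the circle.\<close>

lemma fourier_coeff_cong:
  assumes "finite A" "\<And>z. norm z = 1 \<Longrightarrow> z \<notin> A \<Longrightarrow> f z = g z"
  shows "fourier_coeff f n = fourier_coeff g n"
  unfolding fourier_coeff_def
  using assms by (intro contour_integral_spike_finite_simple_path[of A]) (auto simp: simple_path_circlepath)

lemma fourier_coeff_integrable:
  assumes "continuous_on (sphere 0 1) f"
  shows "(\<lambda>z. z powi (- n) * f z / (2 * complex_of_real pi * \<i> * z)) contour_integrable_on circlepath 0 1"
  using assms
  by (intro contour_integrable_continuous_circlepath continuous_intros) auto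

lemma fourier_coeff_add:
  assumes "continuous_on (sphere 0 1) f" "continuous_on (sphere 0 1) g"
  shows "fourier_coeff (\<lambda>z. f z + g z) n = fourier_coeff f n + fourier_coeff g n"
  unfolding fourier_coeff_def
  using contour_integral_add[OF fourier_coeff_integrable[OF assms(1), of n] fourier_coeff_integrable[OF assms(2), of n]]
  by (simp add: distrib_left add_divide_distrib)

text \<open>Absolute summability gives uniform convergence on the circle, which permits integration
  term by term. Arbitrary exponents and the extra factor \<open>f\<close> cover analytic series,
  antianalytic series and products at once.\<close>

lemma fourier_coeff_sums:
  assumes c: "l1 c" and f: "continuous_on (sphere 0 1) f"
  shows "(\<lambda>m. c m * fourier_coeff f (n - e m)) sums fourier_coeff (\<lambda>z. (\<Sum>m. c m * z powi e m) * f z) n"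
proof -
  define G where "G m z = z powi (- (n - e m)) * f z / (2 * complex_of_real pi * \<i> * z)" for m z
  have int: "G m contour_integrable_on circlepath 0 1" for m
    unfolding G_def using f by (rule fourier_coeff_integrable)
  obtain B where "\<forall>y\<in>f ` sphere 0 1. norm y \<le> B"
    using compact_imp_bounded[OF compact_continuous_image[OF f compact_sphere]] unfolding bounded_iff by blast
  then have B: "norm (f z) \<le> B" if "z \<in> sphere 0 1" for z
    using that by blast
  have lim: "uniform_limit (sphere 0 1) (\<lambda>M z. \<Sum>m<M. c m * G m z) (\<lambda>z. \<Sum>m. c m * G m z) sequentially"
  proof (rule Weierstrass_m_test)
    show "norm (c m * G m z) \<le> norm (c m) * (B / (2 * pi))" if "z \<in> sphere 0 1" for m z
      using that B[OF that]
      by (auto simp: G_def norm_mult norm_divide norm_power_int intro!: mult_left_mono divide_right_mono)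
    show "summable (\<lambda>m. norm (c m) * (B / (2 * pi)))"
      using c by (rule summable_mult2)
  qed
  have "(\<lambda>M. contour_integral (circlepath 0 1) (\<lambda>z. \<Sum>m<M. c m * G m z))
      \<longlonglongrightarrow> contour_integral (circlepath 0 1) (\<lambda>z. \<Sum>m. c m * G m z)"
  proof (rule contour_integral_uniform_limit_circlepath(2)[OF _ lim])
    show "\<forall>\<^sub>F M in sequentially. (\<lambda>z. \<Sum>m<M. c m * G m z) contour_integrable_on circlepath 0 1"
      by (intro always_eventually allI contour_integrable_sum contour_integrable_lmul[OF int]) simp
  qed auto
  moreover have "contour_integral (circlepath 0 1) (\<lambda>z. \<Sum>m<M. c m * G m z)
      = (\<Sum>m<M. c m * fourier_coeff f (n - e m))" for M
  proof -
    have "contour_integral (circlepath 0 1) (\<lambda>z. \<Sum>m<M. c m * G m z)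
        = (\<Sum>m<M. contour_integral (circlepath 0 1) (\<lambda>z. c m * G m z))"
      by (intro contour_integral_sum contour_integrable_lmul[OF int]) simp
    moreover have "contour_integral (circlepath 0 1) (G m) = fourier_coeff f (n - e m)" for m
      by (simp add: G_def[abs_def] fourier_coeff_def)
    ultimately show ?thesis
      by (simp only: contour_integral_lmul[OF int])
  qed
  moreover have "contour_integral (circlepath 0 1) (\<lambda>z. \<Sum>m. c m * G m z)
      = fourier_coeff (\<lambda>z. (\<Sum>m. c m * z powi e m) * f z) n"
    unfolding fourier_coeff_def
  proof (rule contour_integral_cong[OF refl])
    fix z :: complex assume "z \<in> path_image (circlepath 0 1)"
    then have z: "norm z = 1" "z \<noteq> 0" by auto
    define w where "w = z powi (- n) * f z / (2 * complex_of_real pi * \<i> * z)"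
    have "l1 (\<lambda>m. c m * z powi e m)"
      using c z by (simp add: norm_mult norm_power_int)
    then have "(\<Sum>m. c m * z powi e m * w) = (\<Sum>m. c m * z powi e m) * w"
      by (rule suminf_mult2[symmetric, OF summable_norm_cancel])
    moreover have "c m * G m z = c m * z powi e m * w" for m
      using z by (simp add: G_def w_def power_int_diff power_int_minus divide_simps)
    ultimately show "(\<Sum>m. c m * G m z) = z powi (- n) * ((\<Sum>m. c m * z powi e m) * f z) / (2 * complex_of_real pi * \<i> * z)"
      by (simp add: w_def)
  qed
  ultimately show ?thesis
    by (simp add: sums_def)
qed

lemma fourier_coeff_one: "fourier_coeff (\<lambda>_. 1) n = (if n = 0 then 1 else 0)"
proof (cases "n = 0")
  case True
  have "((\<lambda>z. 1 / (2 * complex_of_real pi * \<i>) * (1 / (z - 0))) has_contour_integral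
      1 / (2 * complex_of_real pi * \<i>) * (2 * of_real pi * \<i>)) (circlepath 0 1)"
    by (intro has_contour_integral_lmul)
      (use Cauchy_integral_circlepath_simple[of "\<lambda>_. 1" 0 1 0] in \<open>simp add: mult_ac\<close>)
  then show ?thesis
    using True by (simp add: fourier_coeff_def contour_integral_unique)
next
  case False
  let ?F = "\<lambda>z::complex. z powi (- n) / (of_int (- n) * (2 * of_real pi * \<i>))"
  have "((\<lambda>z. z powi (- n) * 1 / (2 * complex_of_real pi * \<i> * z)) has_contour_integral 0) (circlepath 0 1)"
  proof (rule Cauchy_theorem_primitive[of "- {0}" ?F])
    fix z :: complex assume "z \<in> - {0}"
    then show "(?F has_field_derivative z powi (- n) * 1 / (2 * complex_of_real pi * \<i> * z)) (at z within - {0})"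
      using False by (auto intro!: derivative_eq_intros simp: power_int_diff power_int_minus divide_simps)
  qed auto
  then show ?thesis
    using False by (simp add: fourier_coeff_def contour_integral_unique)
qed

lemma fourier_coeff_suminf:
  assumes c: "l1 c" and e: "inj e"
  shows fourier_coeff_suminf_range: "fourier_coeff (\<lambda>z. \<Sum>m. c m * z powi e m) (e l) = c l"
    and fourier_coeff_suminf_not_range: "n \<notin> range e \<Longrightarrow> fourier_coeff (\<lambda>z. \<Sum>m. c m * z powi e m) n = 0"
proof -
  have sums: "(\<lambda>m. c m * (if n = e m then 1 else 0)) sums fourier_coeff (\<lambda>z. \<Sum>m. c m * z powi e m) n" for n
    using fourier_coeff_sums[OF c continuous_on_const, of 1 n e] by (simp add: fourier_coeff_one)
  have "(\<lambda>m. c m * (if e l = e m then 1 else 0)) = (\<lambda>m. if m = l then c m else 0)"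
    using injD[OF e] by auto
  then show "fourier_coeff (\<lambda>z. \<Sum>m. c m * z powi e m) (e l) = c l"
    using sums_unique2[OF sums[of "e l"]] sums_single[of l c] by simp
  assume "n \<notin> range e"
  then have "n \<noteq> e m" for m
    by blast
  then have "(\<lambda>m. c m * (if n = e m then 1 else 0)) = (\<lambda>m. 0)"
    by simp
  then show "fourier_coeff (\<lambda>z. \<Sum>m. c m * z powi e m) n = 0"
    using sums_unique2[OF sums[of n]] sums_zero by simp
qed

section \<open>Analytic and antianalytic series on the unit circle\<close>

lemma continuous_on_circle_suminf:
  assumes "l1 c"
  shows "continuous_on (sphere 0 1) (\<lambda>z. \<Sum>m. c m * z powi e m)"
proof (rule uniform_limit_theorem)
  show "\<forall>\<^sub>F M in sequentially. continuous_on (sphere 0 1) (\<lambda>z::complex. \<Sum>m<M. c m * z powi e m)"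
    by (intro always_eventually allI continuous_intros) auto
  show "uniform_limit (sphere 0 1) (\<lambda>M z. \<Sum>m<M. c m * z powi e m) (\<lambda>z. \<Sum>m. c m * z powi e m) sequentially"
    by (rule Weierstrass_m_test[OF _ assms]) (simp add: norm_mult norm_power_int)
qed auto

lemma fourier_coeff_nonneg_series:
  assumes "l1 c"
  shows "fourier_coeff (\<lambda>z. \<Sum>m. c m * z ^ m) n = (if n \<ge> 0 then c (nat n) else 0)"
proof (cases "n \<ge> 0")
  case True
  then show ?thesis
    using fourier_coeff_suminf_range[OF assms, of int "nat n"] by (simp add: inj_def)
next
  case False
  then have "n \<notin> range int" by auto
  then show ?thesis
    using fourier_coeff_suminf_not_range[OF assms, of int n] False by (simp add: inj_def)
qed

lemma fourier_coeff_nonpos_series: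
  assumes "l1 c"
  shows "fourier_coeff (\<lambda>z. \<Sum>m. c m * z powi (- int m)) n = (if n \<le> 0 then c (nat (- n)) else 0)"
proof (cases "n \<le> 0")
  case True
  then show ?thesis
    using fourier_coeff_suminf_range[OF assms, of "\<lambda>m. - int m" "nat (- n)"] by (simp add: inj_def)
next
  case False
  then have "n \<notin> range (\<lambda>m. - int m)" by auto
  then show ?thesis
    using fourier_coeff_suminf_not_range[OF assms, of "\<lambda>m. - int m" n] False by (simp add: inj_def)
qed

text \<open>Coefficient \<open>i\<close> of the product involves only the coefficients i + m of
  \<open>f\<close> with nonnegative m, so the antianalytic part of \<open>f\<close> leaves no trace
  at nonnegative indices.\<close>

lemma fourier_coeff_antianalytic_mult:
  assumes v: "l1 v" and f: "continuous_on (sphere 0 1) f" "\<And>i. fourier_coeff f (int i) = x i"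
  shows "fourier_coeff (\<lambda>z. (\<Sum>m. v m * z powi (- int m)) * f z) (int i) = corr v x i"
  using sums_unique[OF fourier_coeff_sums[OF v f(1), where e = "\<lambda>m. - int m" and n = "int i"]]
  unfolding corr_def f(2)[symmetric] by simp

lemma fourier_coeff_toep_entry:
  assumes v: "l1 v" and u: "l1 u"
  shows "fourier_coeff (\<lambda>z. (\<Sum>m. v m * z powi (- int m)) * (\<Sum>m. u m * z ^ m)) (int i - int j) = toep_entry u v i j"
proof -
  have "continuous_on (sphere 0 1) (\<lambda>z. \<Sum>m. u m * z ^ m)"
    using continuous_on_circle_suminf[OF u, of int] by simp
  from sums_unique[OF fourier_coeff_sums[OF v this, where e = "\<lambda>m. - int m" and n = "int i - int j"]]
  have "fourier_coeff (\<lambda>z. (\<Sum>m. v m * z powi (- int m)) * (\<Sum>m. u m * z ^ m)) (int i - int j)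
      = (\<Sum>m. v m * fourier_coeff (\<lambda>z. \<Sum>m. u m * z ^ m) (int i - int j - - int m))"
    by simp
  also have "\<dots> = toep_entry u v i j"
    unfolding toep_entry_def corr_def
  proof (rule suminf_cong)
    fix m
    have "nat (int i - int j - - int m) = i + m - j" by simp
    then show "v m * fourier_coeff (\<lambda>z. \<Sum>m. u m * z ^ m) (int i - int j - - int m) = v m * shift j u (i + m)"
      unfolding fourier_coeff_nonneg_series[OF u] shift_def by auto
  qed
  finally show ?thesis .
qed

lemma holomorphic_on_ball_power_series:
  assumes f: "f holomorphic_on ball 0 R" and R: "R > 1"
  obtains c where "l1 c" "\<And>z. norm z \<le> 1 \<Longrightarrow> (\<lambda>n. c n * z ^ n) sums f z"
proof
  define c where "c n = (deriv ^^ n) f 0 / fact n" for n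
  have sums: "(\<lambda>n. c n * z ^ n) sums f z" if "norm z < R" for z
    using holomorphic_power_series[OF f, of z] that by (simp add: c_def)
  then show "(\<lambda>n. c n * z ^ n) sums f z" if "norm z \<le> 1" for z
    using that R by simp
  \<comment> \<open>The series converges at this point strictly between the unit circle and the
    boundary of the disc, hence absolutely at 1.\<close>
  have "norm (complex_of_real ((1 + R) / 2)) = (1 + R) / 2"
    unfolding norm_of_real using R by simp
  then have "summable (\<lambda>n. c n * complex_of_real ((1 + R) / 2) ^ n)" "norm (1::complex) < norm (complex_of_real ((1 + R) / 2))"
    using R by (auto intro!: sums_summable[OF sums] simp del: of_real_divide of_real_add)
  then have "summable (\<lambda>n. norm (c n * 1 ^ n))"
    by (rule powser_insidea)
  then show "l1 c" by simp
qed

section \<open>Bordered determinants\<close>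

text \<open>This is Cramer's rule: replacing column 0 of the Toeplitz matrix amounts to
  multiplication by the identity with column 0 replaced by \<open>x\<close>, of determinant
  \<open>x 0\<close>. The tail of \<open>x\<close> goes into the error matrix
  \<open>Z\<close>.\<close>

lemma (in toeplitz_symbol) det_bordered_toep:
  assumes x: "l1 x" "x 0 = 1"
  shows "(\<lambda>n. det (Matrix.mat n n (\<lambda>(i, j). if j = 0 then corr v (conv u x) i else toep_entry u v i j))
      - det (toep n u v)) \<longlonglongrightarrow> 0"
proof -
  define Y where "Y n = Matrix.mat n n (\<lambda>(i, j). if j = 0 then x i else if i = j then 1 else 0)" for n
  define Z where "Z n = Matrix.mat n n (\<lambda>(i, j). if j = 0 then corr v (conv u (tail n x)) i else 0)" for n
  have carr: "Y n \<in> carrier_mat n n" "Z n \<in> carrier_mat n n" for n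
    by (auto simp: Y_def Z_def)
  have "(\<lambda>n. det (toep n u v * Y n + Z n) - det (toep n u v) * det (Y n)) \<longlonglongrightarrow> 0"
  proof (rule det_toep_perturb[OF carr])
    show "entry_norm (Y n - 1\<^sub>m n) \<le> l1_norm x" for n
    proof -
      have "entry_norm (Y n - 1\<^sub>m n) = (\<Sum>i<n. \<Sum>j<n. norm (if j = 0 then x i - (if i = 0 then 1 else 0) else 0))"
        unfolding entry_norm_def by (auto simp: Y_def intro!: sum.cong)
      also have "\<dots> = (\<Sum>i<n. norm (x i - (if i = 0 then 1 else 0)))"
        by (intro sum.cong) (auto simp: if_distrib[of norm] cong: if_cong)
      also have "\<dots> \<le> (\<Sum>i<n. norm (x i))"
        using x(2) by (intro sum_mono) auto
      also have "\<dots> \<le> l1_norm x"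
        unfolding l1_norm_def using x(1) by (intro sum_le_suminf) auto
      finally show ?thesis .
    qed
    have le: "entry_norm (Z n) \<le> l1_norm v * (l1_norm u * l1_norm (tail n x))" for n
    proof -
      have "entry_norm (Z n) = (\<Sum>i<n. \<Sum>j<n. norm (if j = 0 then corr v (conv u (tail n x)) i else 0))"
        unfolding entry_norm_def by (auto simp: Z_def intro!: sum.cong)
      also have "\<dots> = (\<Sum>i<n. norm (corr v (conv u (tail n x)) i))"
        by (intro sum.cong) (auto simp: if_distrib[of norm] cong: if_cong)
      also have "\<dots> \<le> l1_norm v * l1_norm (conv u (tail n x))"
        using l1s x by (intro sum_norm_corr_le l1_conv l1_tail)
      also have "\<dots> \<le> l1_norm v * (l1_norm u * l1_norm (tail n x))"
        using l1s x by (intro mult_left_mono l1_norm_conv l1_norm_nonneg l1_tail)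
      finally show ?thesis .
    qed
    show "(\<lambda>n. entry_norm (Z n)) \<longlonglongrightarrow> 0"
    proof (rule Lim_null_comparison)
      show "\<forall>\<^sub>F n in sequentially. norm (entry_norm (Z n)) \<le> l1_norm v * (l1_norm u * l1_norm (tail n x))"
        using le entry_norm_nonneg by (simp add: always_eventually)
      show "(\<lambda>n. l1_norm v * (l1_norm u * l1_norm (tail n x))) \<longlonglongrightarrow> 0"
        by (intro tendsto_mult_right_zero tendsto_l1_norm_tail x)
    qed
  qed
  moreover have "det (Y n) = 1" for n
  proof -
    have "diag_mat (Y n) = replicate n 1"
      using x(2) by (intro nth_equalityI) (auto simp: diag_mat_def Y_def)
    then show ?thesis
      by (subst det_lower_triangular[where n = n]) (auto simp: Y_def)
  qed
  moreover have "toep n u v * Y n + Z n =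
      Matrix.mat n n (\<lambda>(i, j). if j = 0 then corr v (conv u x) i else toep_entry u v i j)" (is "_ = ?M n") for n
  proof (rule eq_matI)
    fix i j assume "i < dim_row (?M n)" "j < dim_col (?M n)"
    then have ij: "i < n" "j < n" by auto
    have "(toep n u v * Y n) $$ (i, j) = (\<Sum>l<n. toep_entry u v i l * (if j = 0 then x l else if l = j then 1 else 0))"
      using ij by (simp add: toep_def Y_def scalar_prod_def lessThan_atLeast0)
    also have "\<dots> = (if j = 0 then (\<Sum>l<n. toep_entry u v i l * x l) else toep_entry u v i j)"
      using ij by (simp add: if_distrib[of "(*) _"] cong: if_cong)
    finally show "(toep n u v * Y n + Z n) $$ (i, j) = ?M n $$ (i, j)"
      using ij corr_conv_split[OF l1s(1) l1s(3) x(1), of i n] by (simp add: Z_def)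
  qed (auto simp: toep_def Z_def)
  ultimately show ?thesis by simp
qed

text \<open>Rows and columns undergo the same permutation, so the two signs cancel.\<close>

lemma det_reverse:
  assumes A: "(A :: complex mat) \<in> carrier_mat n n"
  shows "det (Matrix.mat n n (\<lambda>(i, j). A $$ (n - 1 - i, n - 1 - j))) = det A"
proof -
  define p where "p i = (if i < n then n - 1 - i else i)" for i
  have p: "p permutes {0..<n}"
    by (rule bij_imp_permutes, rule bij_betw_byWitness[where f' = p]) (auto simp: p_def)
  define B where "B = Matrix.mat n n (\<lambda>(i, j). A $$ (p i, j))"
  have B: "B \<in> carrier_mat n n" by (simp add: B_def)
  have "Matrix.mat n n (\<lambda>(i, j). A $$ (n - 1 - i, n - 1 - j))
      = transpose_mat (Matrix.mat n n (\<lambda>(i, j). transpose_mat B $$ (p i, j)))"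
    using A by (intro eq_matI) (auto simp: B_def p_def)
  also have "det \<dots> = det (Matrix.mat n n (\<lambda>(i, j). transpose_mat B $$ (p i, j)))"
    by (rule det_transpose[of _ n]) simp
  also have "\<dots> = signof p * det (transpose_mat B)"
    using B p by (intro det_permute_rows) auto
  also have "\<dots> = signof p * (signof p * det A)"
    unfolding det_transpose[OF B] unfolding B_def det_permute_rows[OF A p] ..
  finally show ?thesis by (cases "evenperm p") (simp_all add: sign_def)
qed

text \<open>Reversing the order of rows and columns moves the border from the last column to the first and
  turns the entries \<open>\<phi>\<^sub>l\<^sub>-\<^sub>j\<close> into \<open>\<phi>\<^sub>j\<^sub>-\<^sub>l\<close>.\<close>

lemma bordered_toeplitz_det_eq:
  assumes \<phi>: "\<And>i j. fourier_coeff \<phi> (int i - int j) = toep_entry u v i j"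
    and \<psi>: "\<And>i. fourier_coeff \<psi> (int i) = y i"
  shows "bordered_toeplitz_det n \<phi> \<psi>
    = det (Matrix.mat n n (\<lambda>(i, j). if j = 0 then y i else toep_entry u v i j))" (is "_ = det ?M")
proof -
  have "bordered_toeplitz_det n \<phi> \<psi> = det (Matrix.mat n n (\<lambda>(i, j). ?M $$ (n - 1 - i, n - 1 - j)))"
    unfolding bordered_toeplitz_det_def
  proof (intro arg_cong[where f = det] eq_matI)
    fix i j
    assume "i < dim_row (Matrix.mat n n (\<lambda>(i, j). ?M $$ (n - 1 - i, n - 1 - j)))"
      "j < dim_col (Matrix.mat n n (\<lambda>(i, j). ?M $$ (n - 1 - i, n - 1 - j)))"
    then have ij: "i < n" "j < n" by auto
    have "int n - 1 - int i = int (n - 1 - i)" "int j - int i = int (n - 1 - i) - int (n - 1 - j)"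
      using ij by auto
    then have "fourier_coeff \<psi> (int n - 1 - int i) = y (n - 1 - i)"
      "fourier_coeff \<phi> (int j - int i) = toep_entry u v (n - 1 - i) (n - 1 - j)"
      by (simp_all only: \<phi> \<psi>)
    then show "Matrix.mat n n (\<lambda>(j, l). if l = n - 1 then fourier_coeff \<psi> (int n - 1 - int j)
          else fourier_coeff \<phi> (int l - int j)) $$ (i, j)
        = Matrix.mat n n (\<lambda>(i, j). ?M $$ (n - 1 - i, n - 1 - j)) $$ (i, j)"
      using ij by auto
  qed auto
  then show ?thesis
    by (simp only: det_reverse[of ?M n] mat_carrier)
qed

section \<open>Binomial series of the principal square roots\<close>

lemma of_real_gbinomial: "complex_of_real (\<alpha> gchoose n) = of_real \<alpha> gchoose n"
  by (simp add: gbinomial_prod_rev)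

lemma bin_sums:
  assumes "0 \<le> a" "norm z * a < 1"
  shows "(\<lambda>n. bin a \<alpha> n * z ^ n) sums ((1 - of_real a * z) powr of_real \<alpha>)"
proof -
  have "norm (- of_real a * z) < 1"
    using assms by (simp add: norm_mult mult.commute)
  from gen_binomial_complex[OF this, of "of_real \<alpha>"] show ?thesis
    by (simp add: bin_def of_real_gbinomial mult.assoc flip: power_mult_distrib)
qed

lemma bin_sums_csqrt:
  assumes "0 \<le> a" "norm z * a < 1"
  shows "(\<lambda>n. bin a (1 / 2) n * z ^ n) sums csqrt (1 - of_real a * z)"
    and "(\<lambda>n. bin a (- 1 / 2) n * z ^ n) sums inverse (csqrt (1 - of_real a * z))"
proof -
  have "norm (of_real a * z) \<noteq> norm (1 :: complex)"
    using assms by (simp add: norm_mult mult.commute)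
  then have nz: "1 - of_real a * z \<noteq> 0"
    unfolding right_minus_eq by (rule contrapos_nn) (simp only:)
  show "(\<lambda>n. bin a (1 / 2) n * z ^ n) sums csqrt (1 - of_real a * z)"
    using bin_sums[OF assms, of "1 / 2"] nz by (simp add: csqrt_conv_powr)
  show "(\<lambda>n. bin a (- 1 / 2) n * z ^ n) sums inverse (csqrt (1 - of_real a * z))"
    using bin_sums[OF assms, of "- 1 / 2"] nz by (simp add: csqrt_conv_powr powr_minus)
qed

section \<open>The Ising symbols\<close>

lemma mem_ball_inverse_iff:
  assumes "0 < a"
  shows "z \<in> ball 0 (1 / a) \<longleftrightarrow> norm z * a < 1"
  using assms by (simp add: field_simps)

text \<open>The analytic factor \<open>\<phi>\<^sub>+\<close>. Its value at 1/z is the reciprocal of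
  the antianalytic factor \<open>\<phi>\<^sub>-\<close> at z.\<close>

definition chi :: "real \<Rightarrow> complex \<Rightarrow> complex" where
  "chi a z = inverse (csqrt (1 - of_real a * z))"

lemma one_minus_notin_nonpos_Reals:
  fixes z :: complex
  assumes "0 \<le> a" "norm z * a < 1"
  shows "1 - of_real a * z \<notin> \<real>\<^sub>\<le>\<^sub>0"
proof -
  have "Re (of_real a * z) \<le> norm (of_real a * z)"
    by (rule complex_Re_le_cmod)
  also have "\<dots> < 1"
    using assms by (simp add: norm_mult mult.commute)
  finally show ?thesis
    by (simp add: complex_nonpos_Reals_iff)
qed

lemma chi_holomorphic:
  assumes "0 < a"
  shows "chi a holomorphic_on ball 0 (1 / a)"
  unfolding chi_def
proof (intro holomorphic_intros)
  fix z :: complex assume "z \<in> ball 0 (1 / a)"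
  then have "norm z * a < 1"
    using mem_ball_inverse_iff[OF assms] by blast
  then show *: "1 - of_real a * z \<notin> \<real>\<^sub>\<le>\<^sub>0"
    using assms by (intro one_minus_notin_nonpos_Reals) auto
  then show "csqrt (1 - of_real a * z) \<noteq> 0"
    by auto
qed

lemma chi_of_real:
  assumes "1 - a * x = y\<^sup>2" "y > 0"
  shows "chi a (of_real x) = of_real (1 / y)"
proof -
  have "csqrt (1 - of_real a * of_real x) = csqrt (of_real (y\<^sup>2))"
    by (simp flip: assms(1))
  also have "\<dots> = of_real (sqrt (y\<^sup>2))"
    by (rule of_real_sqrt[symmetric]) simp
  finally show ?thesis
    using assms(2) by (simp add: chi_def inverse_eq_divide)
qed

section \<open>Removing the singularity and splitting the border symbol\<close>

definition diff_quot :: "(complex \<Rightarrow> complex) \<Rightarrow> complex \<Rightarrow> complex \<Rightarrow> complex" where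
  "diff_quot f c z = (if z = c then deriv f c else (f z - f c) / (z - c))"

text \<open>The point \<open>c\<close> may lie anywhere relative to \<open>S\<close>. Thus the cases
  of \<open>c\<close> inside, on and outside the unit circle are handled together.\<close>

lemma diff_quot_holomorphic:
  assumes "f holomorphic_on S" "open S"
  shows "diff_quot f c holomorphic_on S"
  unfolding diff_quot_def[abs_def] using assms by (rule pole_lemma_open)

text \<open>The numbers \<open>Sh\<close>, \<open>Sv\<close>, \<open>Ch\<close>, \<open>Cv\<close> are the hyperbolic sines and cosines
  of the reduced couplings, and \<open>a\<close> is the reciprocal of the modulus.\<close>

locale ising_symbol =
  fixes a Sh Sv Ch Cv :: real
  assumes a: "0 < a" "a < 1"
    and pos: "0 < Sh" "0 < Sv" "0 < Ch" "0 < Cv"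
    and aS: "a * (Sh * Sv) = 1"
    and hyp: "Ch\<^sup>2 = 1 + Sh\<^sup>2" "Cv\<^sup>2 = 1 + Sv\<^sup>2"
begin

sublocale toeplitz_symbol a "bin a (- 1 / 2)" "bin a (1 / 2)" "bin a (1 / 2)" "bin a (- 1 / 2)"
  using toeplitz_symbol_bin[of a "- 1 / 2" "1 / 2"] a by simp

definition c :: complex where "c = - of_real Sh / of_real Sv"

definition phi :: "complex \<Rightarrow> complex" where
  "phi z = csqrt (1 - of_real a * inverse z) * chi a z"

text \<open>Since a Sh Sv = 1, the quantity 1 - a c equals 1 + 1 / Sv^2, the square of Cv / Sv, and
  similarly for 1/c. These two values make the numerator of the border symbol vanish at
  \<open>c\<close>.\<close>

lemma chi_c: "chi a c = of_real (Sv / Cv)" and chi_inverse_c: "chi a (inverse c) = of_real (Sh / Ch)"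
proof -
  have "1 - a * (- Sh / Sv) = (Cv / Sv)\<^sup>2"
    using pos aS hyp by (simp add: power_divide divide_simps power2_eq_square) (simp add: algebra_simps)
  from chi_of_real[OF this] show "chi a c = of_real (Sv / Cv)"
    using pos by (simp add: c_def)
  have "1 - a * (- Sv / Sh) = (Ch / Sh)\<^sup>2"
    using pos aS hyp by (simp add: power_divide divide_simps power2_eq_square) (simp add: algebra_simps)
  from chi_of_real[OF this] show "chi a (inverse c) = of_real (Sh / Ch)"
    using pos by (simp add: c_def)
qed

lemma c_nz: "c \<noteq> 0"
  using pos by (simp add: c_def)

lemma unit_circle_sums:
  assumes "norm z = 1"
  shows "(\<Sum>m. bin a (- 1 / 2) m * z ^ m) = chi a z"
    and "(\<Sum>m. bin a (1 / 2) m * z powi (- int m)) = csqrt (1 - of_real a * inverse z)"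
proof -
  show "(\<Sum>m. bin a (- 1 / 2) m * z ^ m) = chi a z"
    unfolding chi_def using bin_sums_csqrt(2)[of a z] assms a by (simp add: sums_iff)
  have "z powi (- int m) = inverse z ^ m" for m
    by (simp add: power_int_minus power_inverse)
  then show "(\<Sum>m. bin a (1 / 2) m * z powi (- int m)) = csqrt (1 - of_real a * inverse z)"
    using bin_sums_csqrt(1)[of a "inverse z"] assms a by (simp add: sums_iff norm_inverse)
qed

lemma fourier_coeff_phi: "fourier_coeff phi (int i - int j) = toep_entry (bin a (- 1 / 2)) (bin a (1 / 2)) i j"
  unfolding fourier_coeff_toep_entry[OF l1s(3) l1s(1), symmetric]
  by (rule fourier_coeff_cong[of "{}"]) (simp_all only: phi_def unit_circle_sums finite.emptyI)

text \<open>Away from \<open>c\<close> this is Cv (z chi(z) - c chi(c)) / (Sv (z - c)), written so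
  that the value at \<open>c\<close> is filled in.\<close>

definition G :: "complex \<Rightarrow> complex" where
  "G z = of_real (Cv / Sv) * (chi a z + c * diff_quot (chi a) c z)"

text \<open>For w = 1/z away from 1/c this is Ch (chi(w) - chi(1/c)) / (Sv (z - c)). The factor w
  makes \<open>H\<close> vanish at 0, so the antianalytic part has no constant term.\<close>

definition H :: "complex \<Rightarrow> complex" where
  "H w = - of_real (Ch / Sv) * (w / c) * diff_quot (chi a) (inverse c) w"

text \<open>Dividing the numerator by \<open>\<phi>\<^sub>-\<close> gives Cv z chi(z) + Ch chi(1/z).
  At \<open>c\<close> the two summands take the values -Sh and Sh; subtracting these does not change
  the sum and makes each fraction regular by itself.\<close>

lemma wiener_hopf_splitting:
  assumes z: "norm z = 1" "z \<noteq> c"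
  shows "(of_real Cv * z * phi z + of_real Ch) / (of_real Sv * (z - c))
    = csqrt (1 - of_real a * inverse z) * (G z + H (inverse z))"
proof -
  define F where "F = csqrt (1 - of_real a * inverse z)"
  define X where "X = chi a z"
  have znz: "z \<noteq> 0" using z by auto
  have "norm (inverse z) * a < 1"
    using z a by (simp add: norm_inverse)
  from one_minus_notin_nonpos_Reals[OF _ this] have Fnz: "F \<noteq> 0"
    using a by (auto simp: F_def)
  have nz: "complex_of_real Sv \<noteq> 0" "complex_of_real Cv \<noteq> 0" "complex_of_real Ch \<noteq> 0" "z - c \<noteq> 0"
    using pos z by auto
  have chiF: "chi a (inverse z) = inverse F"
    by (simp add: chi_def F_def)
  have cS: "c * of_real Sv = - of_real Sh"
    using nz by (simp add: c_def)
  have G: "G z = of_real Cv / of_real Sv * (X + c * (X - of_real Sv / of_real Cv) / (z - c))"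
    using z by (simp add: G_def diff_quot_def X_def chi_c)
  have "inverse z \<noteq> inverse c"
    using z by simp
  then have "H (inverse z) = - (of_real Ch / of_real Sv) * (inverse z / c * ((inverse F - of_real Sh / of_real Ch) / (inverse z - inverse c)))"
    by (simp add: H_def diff_quot_def chiF chi_inverse_c mult_ac)
  also have "inverse z / c * ((inverse F - of_real Sh / of_real Ch) / (inverse z - inverse c))
      = - ((inverse F - of_real Sh / of_real Ch) / (z - c))"
  proof -
    have "inverse z - inverse c = - ((z - c) * (inverse z / c))"
      using znz c_nz by (simp add: field_simps)
    then show ?thesis
      using znz c_nz by simp
  qed
  finally have H: "H (inverse z) = of_real Ch / of_real Sv * ((inverse F - of_real Sh / of_real Ch) / (z - c))"
    by simp
  have "F * (G z + H (inverse z)) * (of_real Sv * (z - c))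
      = F * (of_real Cv * (X * (z - c) + c * (X - of_real Sv / of_real Cv)) + of_real Ch * (inverse F - of_real Sh / of_real Ch))"
    unfolding G H using nz by (simp add: divide_simps)
  also have "\<dots> = of_real Cv * z * (F * X) - F * (c * of_real Sv) + of_real Ch - F * of_real Sh"
    using nz Fnz by (simp add: field_simps)
  also have "\<dots> = of_real Cv * z * phi z + of_real Ch"
    by (simp add: cS phi_def F_def X_def)
  finally show ?thesis
    using nz by (simp add: F_def field_simps)
qed

lemma border_coefficients:
  assumes \<psi>: "\<And>z. norm z = 1 \<Longrightarrow> z \<noteq> c \<Longrightarrow> \<psi> z = (of_real Cv * z * phi z + of_real Ch) / (of_real Sv * (z - c))"
  obtains g where "l1 g" "g 0 = 1" "\<And>i. fourier_coeff \<psi> (int i) = corr (bin a (1 / 2)) g i"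
proof -
  have R: "1 / a > 1" using a by simp
  have hol: "G holomorphic_on ball 0 (1 / a)" "H holomorphic_on ball 0 (1 / a)"
    unfolding G_def[abs_def] H_def[abs_def] using c_nz a
    by (auto intro!: holomorphic_intros chi_holomorphic diff_quot_holomorphic)
  obtain g where g: "l1 g" "\<And>z. norm z \<le> 1 \<Longrightarrow> (\<lambda>n. g n * z ^ n) sums G z"
    using holomorphic_on_ball_power_series[OF hol(1) R] by blast
  obtain h where h: "l1 h" "\<And>z. norm z \<le> 1 \<Longrightarrow> (\<lambda>n. h n * z ^ n) sums H z"
    using holomorphic_on_ball_power_series[OF hol(2) R] by blast
  have "g 0 = G 0"
    using sums_unique2[OF g(2)[of 0] powser_sums_zero] by simp
  \<comment> \<open>At 0 the difference quotient is (chi(c) - 1) / c, so the bracket in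
    \<open>G\<close> reduces to chi(c) = Sv / Cv.\<close>
  also have "G 0 = 1"
    using c_nz pos by (simp add: G_def diff_quot_def chi_c)
  finally have g0: "g 0 = 1" .
  have "h 0 = H 0"
    using sums_unique2[OF h(2)[of 0] powser_sums_zero] by simp
  then have h0: "h 0 = 0"
    by (simp add: H_def)
  define f where "f z = (\<Sum>m. g m * z ^ m) + (\<Sum>m. h m * z powi (- int m))" for z
  have cont: "continuous_on (sphere 0 1) (\<lambda>z. \<Sum>m. g m * z ^ m)"
    "continuous_on (sphere 0 1) (\<lambda>z. \<Sum>m. h m * z powi (- int m))"
    using continuous_on_circle_suminf[OF g(1), of int] continuous_on_circle_suminf[OF h(1), of "\<lambda>m. - int m"]
    by simp_all
  \<comment> \<open>The two series overlap only at index 0, where \<open>h\<close> vanishes.\<close>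
  have "fourier_coeff f (int i) = g i" for i
    unfolding f_def fourier_coeff_add[OF cont] fourier_coeff_nonneg_series[OF g(1)]
      fourier_coeff_nonpos_series[OF h(1)] using h0 by simp
  moreover have "continuous_on (sphere 0 1) f"
    unfolding f_def by (intro continuous_on_add cont)
  ultimately have "fourier_coeff (\<lambda>z. (\<Sum>m. bin a (1 / 2) m * z powi (- int m)) * f z) (int i) = corr (bin a (1 / 2)) g i" for i
    using l1s by (intro fourier_coeff_antianalytic_mult)
  moreover have "fourier_coeff \<psi> (int i) = fourier_coeff (\<lambda>z. (\<Sum>m. bin a (1 / 2) m * z powi (- int m)) * f z) (int i)" for i
  proof (rule fourier_coeff_cong[of "{c}"])
    fix z :: complex assume z: "norm z = 1" "z \<notin> {c}"
    have "z powi (- int m) = inverse z ^ m" for m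
      by (simp add: power_int_minus power_inverse)
    then have "f z = G z + H (inverse z)"
      using g(2)[of z] h(2)[of "inverse z"] z by (simp add: f_def sums_iff norm_inverse)
    then show "\<psi> z = (\<Sum>m. bin a (1 / 2) m * z powi (- int m)) * f z"
      using z \<psi>[of z] wiener_hopf_splitting[of z] by (simp only: unit_circle_sums) simp
  qed simp
  ultimately show thesis
    using that[OF g(1) g0] by simp
qed

theorem bordered_toeplitz_det_tendsto:
  assumes \<psi>: "\<And>z. norm z = 1 \<Longrightarrow> z \<noteq> c \<Longrightarrow> \<psi> z = (of_real Cv * z * phi z + of_real Ch) / (of_real Sv * (z - c))"
  shows "(\<lambda>n. bordered_toeplitz_det n phi \<psi>) \<longlonglongrightarrow> of_real ((1 - a\<^sup>2) powr (1 / 4))"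
proof -
  let ?u = "bin a (- 1 / 2)" and ?v = "bin a (1 / 2)"
  obtain g where g: "l1 g" "g 0 = 1" "\<And>i. fourier_coeff \<psi> (int i) = corr ?v g i"
    using border_coefficients[OF \<psi>] by blast
  \<comment> \<open>The sequence \<open>?v\<close> is also the inverse of \<open>?u\<close>, so
    \<open>x\<close> consists of the coefficients of g / \<open>\<phi>\<^sub>+\<close>, and applying
    \<open>conv ?u\<close> recovers \<open>g\<close>.\<close>
  define x where "x = conv ?v g"
  have x: "l1 x" "x 0 = 1"
    using l1_conv[OF l1s(3) g(1)] g(2) by (simp_all add: x_def conv_0)
  have ux: "conv ?u x = g"
    unfolding x_def conv_assoc[symmetric] inv by simp
  have "bordered_toeplitz_det n phi \<psi>
      = det (Matrix.mat n n (\<lambda>(i, j). if j = 0 then corr ?v (conv ?u x) i else toep_entry ?u ?v i j))" for n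
    unfolding ux by (rule bordered_toeplitz_det_eq[OF fourier_coeff_phi g(3)])
  then have "(\<lambda>n. bordered_toeplitz_det n phi \<psi> - det (toep n ?u ?v)) \<longlonglongrightarrow> 0"
    using det_bordered_toep[OF x] by simp
  from tendsto_add[OF this dbin_half_tendsto[of a, unfolded dbin_def]] show ?thesis
    using a by simp
qed

end

theorem theorem1p4:
  fixes Jh Jv kB T k :: real
  assumes "Jh > 0" and "Jv > 0" and "kB > 0" and "T > 0"
    and k_def: "k = sinh (2 * Jh / (kB * T)) * sinh (2 * Jv / (kB * T))"
    and "k > 1"
    and Au_Yang_Perk: "\<And>N :: nat. N \<ge> 1 \<Longrightarrow>
      complex_of_real (ising_correlation Jh Jv kB T (int N - 1, int N)) =
        bordered_toeplitz_det N (phi_hat Jh Jv kB T) (psi_hat Jh Jv kB T)"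
  shows "(\<lambda>N :: nat. ising_correlation Jh Jv kB T (int N - 1, int N))
           \<longlonglongrightarrow> (1 - k powi (- 2)) powr (1 / 4)"
proof -
  let ?Sh = "sinh (2 * Jh / (kB * T))" and ?Sv = "sinh (2 * Jv / (kB * T))"
  let ?Ch = "cosh (2 * Jh / (kB * T))" and ?Cv = "cosh (2 * Jv / (kB * T))"
  interpret ising_symbol "inverse k" ?Sh ?Sv ?Ch ?Cv
  proof
    show "inverse k * (?Sh * ?Sv) = 1"
      using assms(6) by (simp flip: k_def)
  qed (use assms(1-4,6) in \<open>simp_all add: cosh_square_eq inverse_less_1_iff\<close>)
  have modulus: "ising_modulus Jh Jv kB T = k"
    by (simp add: ising_modulus_def k_def)
  have phi: "phi_hat Jh Jv kB T = phi"
    by (rule ext) (simp add: phi_hat_def phi_def chi_def modulus divide_inverse Let_def)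
  \<comment> \<open>The value at \<open>c\<close>, defined by a limit, is left aside: agreement on
    the circle away from one point determines the Fourier coefficients.\<close>
  have psi: "psi_hat Jh Jv kB T z = (of_real ?Cv * z * phi z + of_real ?Ch) / (of_real ?Sv * (z - c))" if "z \<noteq> c" for z
    using that by (simp add: psi_hat_def Let_def phi c_def)
  have "(\<lambda>N. bordered_toeplitz_det N (phi_hat Jh Jv kB T) (psi_hat Jh Jv kB T))
      \<longlonglongrightarrow> of_real ((1 - (inverse k)\<^sup>2) powr (1 / 4))"
    unfolding phi by (rule bordered_toeplitz_det_tendsto) (rule psi)
  then have "(\<lambda>N. complex_of_real (ising_correlation Jh Jv kB T (int N - 1, int N)))
      \<longlonglongrightarrow> of_real ((1 - (inverse k)\<^sup>2) powr (1 / 4))"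
    \<comment> \<open>The determinant representation is available from N = 1 on, which suffices for
      the limit.\<close>
    by (rule Lim_transform_eventually) (auto simp: Au_Yang_Perk intro!: eventually_sequentiallyI[of 1])
  then have "(\<lambda>N. ising_correlation Jh Jv kB T (int N - 1, int N)) \<longlonglongrightarrow> (1 - (inverse k)\<^sup>2) powr (1 / 4)"
    by (subst (asm) tendsto_of_real_iff)
  moreover have "k powi (- 2) = (inverse k)\<^sup>2"
    by (simp add: power_int_minus power_inverse)
  ultimately show ?thesis
    by simp
qed

end
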